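(* Let $\mathcal W_1,\dots,\mathcal W_r$ be nontrivial pairwise non-isomorphic rational irreducible representations of $G$, with associated complex irreducible representations $V_1,\dots,V_r$, and let $H\le G$ be such that Hypothesis ( * ) of the context holds. Then the correspondence $\mathcal K_X$ satisfies the cubic equation $$(\mathcal K_X-\Delta_X)(\mathcal K_X+(q-1)\Delta_X)(\mathcal K_X-\deg\mathcal K_X\cdot\Delta_X)=0,$$ where $\Delta_X$ is the diagonal in $X\times X$ and $q$ is the positive integer $q=\frac{|G|}{b\cdot n}$ (in particular this number is an integer).
   Context: Curves are smooth projective over an algebraically closed field of characteristic $0$. $G$ is a finite group acting on a curve $Z$ so that $\pi:Z\to Y=Z/G$ is a Galois covering with Galois group $G$; $H\le G$, $X=Z/H$, with induced maps $\pi_H:Z\to X$ and $\varphi_H:X\to Y$. Correspondences on $X$ (elements of $\mathrm{Div}(X\times X)$) are described by the maps $x\mapsto D(x)$ to divisors on $X$; products are compositions of correspondences, $\Delta_X$ is the identity, and $\deg D=\deg D(x)$. Representations: for a complex irreducible representation $V$ of $G$ with character $\chi_V$, $K_V=\mathbb Q(\chi_V(g)\mid g\in G)$. A rational irreducible representation $\mathcal W$ has an associated complex irreducible representation $V$ (unique up to Galois conjugacy): $\mathcal W\otimes_{\mathbb Q}\mathbb C\simeq m_V\bigoplus_{\tau\in\mathrm{Gal}(K_V/\mathbb Q)}V^\tau$, with $m_V$ the Schur index. Hypothesis ( * ): for all $k$: (a) $\dim V_k=n$ is independent of $k$; (b) $K_{V_k}=L$ is independent of $k$; (c) $\dim V_k^H=1$;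 (d) for every subgroup $N$ of $G$ with $H\subsetneq N$ there is an index $k$ with $\dim V_k^N=0$. Let $H_1=H,\dots,H_d$ be the double cosets of $H$ in $G$, and $\{g_{ij}\mid 1\le i\le d,\ 1\le j\le n_i\}$ representatives for both the left and the right cosets of $H$ in $G$, with $g_{11}=1$ and $H_i=Hg_{i1}H=\bigsqcup_j g_{ij}H=\bigsqcup_j Hg_{ij}$. Put $a_{ki}=\sum_{h\in H}\mathrm{tr}_{L/\mathbb Q}(\chi_{V_k}(hg_{i1}^{-1}))\in\mathbb Z$, $b_i=\sum_{k=1}^r a_{ki}$, $b=\gcd\{b_1-b_i\mid 2\le i\le d\}$. Define $\overline{\mathcal D}(x)=\sum_{i=1}^d b_i\sum_{j=1}^{n_i}\pi_H(g_{ij}(z))$ for $x\in X$, $z\in Z$ any preimage of $x$; the trace correspondence $\mathcal T_{X/Y}(x)=\varphi_H^*\varphi_H(x)=\sum_{i,j}\pi_H(g_{ij}(z))$; and the Kanev correspondence $$\mathcal K_X:=\Delta_X-\tfrac1b\overline{\mathcal D}+\left(\tfrac{b_1}{b}-1\right)\mathcal T_{X/Y},$$ which is an integral correspondence. *)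

theory Defs
  imports
    "Jordan_Normal_Form.VS_Connect"
    "HOL-Algebra.Embedded_Algebras"
    "HOL-Algebra.Generated_Fields"
    "HOL-Algebra.Group_Action"
    "HOL-Library.Poly_Mapping"
    "HOL-Library.Disjoint_Sets"
begin

text \<open>
  Points of \<open>P\<^sup>N\<close> are represented as punctured lines: the set of all homogeneous coordinate
  vectors (nonzero elements of \<open>k\<^sup>N\<^sup>+\<^sup>1\<close>) of the point.  So \<open>v \<in> p\<close> reads ``\<open>v\<close> is a vector of
  homogeneous coordinates of \<open>p\<close>''.
\<close>

type_synonym 'k point = "'k vec set"

definition line_of :: "'k::field vec \<Rightarrow> 'k point" where
  "line_of v = {c \<cdot>\<^sub>v v | c. c \<noteq> 0}"

definition proj_space :: "nat \<Rightarrow> 'k::field point set" where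
  "proj_space N = line_of ` {v \<in> carrier_vec (Suc N). v \<noteq> 0\<^sub>v (Suc N)}"

text \<open>Polynomials are finitely supported families of coefficients, indexed by exponent vectors.\<close>

type_synonym 'k mpoly = "(nat \<Rightarrow>\<^sub>0 nat) \<Rightarrow>\<^sub>0 'k"

definition mp_eval :: "'k::field mpoly \<Rightarrow> 'k vec \<Rightarrow> 'k" where
  "mp_eval f v = (\<Sum>m\<in>Poly_Mapping.keys f.
     Poly_Mapping.lookup f m * (\<Prod>i\<in>Poly_Mapping.keys m. v $ i ^ Poly_Mapping.lookup m i))"

definition mp_deriv :: "nat \<Rightarrow> 'k::field mpoly \<Rightarrow> 'k mpoly" where
  "mp_deriv i f = (\<Sum>m\<in>Poly_Mapping.keys f.
     Poly_Mapping.single (m - Poly_Mapping.single i 1)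
       (of_nat (Poly_Mapping.lookup m i) * Poly_Mapping.lookup f m))"

definition forms :: "nat \<Rightarrow> nat \<Rightarrow> 'k::field mpoly set" where
  "forms N e = {f. \<forall>m\<in>Poly_Mapping.keys f. Poly_Mapping.keys m \<subseteq> {..N} \<and>
     (\<Sum>i\<in>Poly_Mapping.keys m. Poly_Mapping.lookup m i) = e}"

definition zero_locus :: "nat \<Rightarrow> 'k::field mpoly set \<Rightarrow> 'k point set" where
  "zero_locus N S = {p \<in> proj_space N. \<forall>f\<in>S. \<forall>v\<in>p. mp_eval f v = 0}"

definition vanishing_forms :: "nat \<Rightarrow> 'k::field point set \<Rightarrow> 'k mpoly set" where
  "vanishing_forms N Z = {f. (\<exists>e. f \<in> forms N e) \<and> (\<forall>p\<in>Z. \<forall>v\<in>p. mp_eval f v = 0)}"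

definition zariski_closed :: "nat \<Rightarrow> 'k::field point set \<Rightarrow> bool" where
  "zariski_closed N Z \<longleftrightarrow> (\<exists>S \<subseteq> (\<Union>e. forms N e). Z = zero_locus N S)"

definition zariski_open_in :: "nat \<Rightarrow> 'k::field point set \<Rightarrow> 'k point set \<Rightarrow> bool" where
  "zariski_open_in N Z U \<longleftrightarrow> (\<exists>C. zariski_closed N C \<and> U = Z - C)"

definition projective_variety :: "nat \<Rightarrow> 'k::field point set \<Rightarrow> bool" where
  "projective_variety N Z \<longleftrightarrow> zariski_closed N Z \<and> Z \<noteq> {} \<and>
     (\<forall>A B. zariski_closed N A \<and> zariski_closed N B \<and> Z = A \<union> B \<longrightarrow> Z = A \<or> Z = B)"

definition has_variety_chain :: "nat \<Rightarrow> 'k::field point set \<Rightarrow> nat \<Rightarrow> bool" where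
  "has_variety_chain N Z l \<longleftrightarrow> (\<exists>C :: nat \<Rightarrow> 'k point set.
     (\<forall>i\<le>l. projective_variety N (C i) \<and> C i \<subseteq> Z) \<and> (\<forall>i<l. C i \<subset> C (Suc i)))"

definition has_dimension :: "nat \<Rightarrow> 'k::field point set \<Rightarrow> nat \<Rightarrow> bool" where
  "has_dimension N Z l \<longleftrightarrow> has_variety_chain N Z l \<and> \<not> has_variety_chain N Z (Suc l)"

definition subspace_dim :: "nat \<Rightarrow> 'a::field vec set \<Rightarrow> nat" where
  "subspace_dim n U = vectorspace.dim class_ring ((module_vec TYPE('a) n)\<lparr>carrier := U\<rparr>)"

text \<open>
  Jacobian criterion: the kernel of the Jacobian matrix of the homogeneous ideal at a vector \<open>v\<close>
  is the tangent space to the affine cone over \<open>Z\<close> at \<open>v\<close>; it has dimension \<open>dim Z + 1\<close> exactly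
  when the point is nonsingular.
\<close>

definition cone_tangent_space :: "nat \<Rightarrow> 'k::field point set \<Rightarrow> 'k vec \<Rightarrow> 'k vec set" where
  "cone_tangent_space N Z v = {w \<in> carrier_vec (Suc N).
     \<forall>f\<in>vanishing_forms N Z. (\<Sum>i\<le>N. mp_eval (mp_deriv i f) v * w $ i) = 0}"

definition smooth_projective_curve :: "nat \<Rightarrow> 'k::field point set \<Rightarrow> bool" where
  "smooth_projective_curve N Z \<longleftrightarrow> projective_variety N Z \<and> has_dimension N Z 1 \<and>
     (\<forall>p\<in>Z. \<forall>v\<in>p. subspace_dim (Suc N) (cone_tangent_space N Z v) = 2)"

definition is_morphism ::
    "nat \<Rightarrow> 'k::field point set \<Rightarrow> nat \<Rightarrow> 'k point set \<Rightarrow> ('k point \<Rightarrow> 'k point) \<Rightarrow> bool" where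
  "is_morphism N Z M X f \<longleftrightarrow> f ` Z \<subseteq> X \<and>
     (\<forall>z\<in>Z. \<exists>e F. (\<forall>j\<le>M. F j \<in> forms N e) \<and>
        (\<exists>v\<in>z. vec (Suc M) (\<lambda>j. mp_eval (F j) v) \<noteq> 0\<^sub>v (Suc M)) \<and>
        (\<forall>z'\<in>Z. \<forall>v\<in>z'. vec (Suc M) (\<lambda>j. mp_eval (F j) v) \<noteq> 0\<^sub>v (Suc M) \<longrightarrow>
           vec (Suc M) (\<lambda>j. mp_eval (F j) v) \<in> f z'))"

definition regular_function :: "nat \<Rightarrow> 'k::field point set \<Rightarrow> ('k point \<Rightarrow> 'k) \<Rightarrow> bool" where
  "regular_function N U f \<longleftrightarrow>
     (\<forall>z\<in>U. \<exists>e A B. A \<in> forms N e \<and> B \<in> forms N e \<and> (\<exists>v\<in>z. mp_eval B v \<noteq> 0) \<and>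
        (\<forall>z'\<in>U. \<forall>v\<in>z'. mp_eval B v \<noteq> 0 \<longrightarrow> f z' = mp_eval A v / mp_eval B v))"

text \<open>
  \<open>\<pi> : Z \<rightarrow> X\<close> exhibits the curve \<open>X\<close> as the geometric quotient of \<open>Z\<close> by the group \<open>A\<close> acting
  through \<open>act\<close>: the fibres are the orbits, \<open>X\<close> has the quotient topology, and the regular functions
  on \<open>U \<subseteq> X\<close> are the invariant regular functions on the preimage of \<open>U\<close>.
\<close>

definition quotient_curve ::
    "nat \<Rightarrow> 'k::field point set \<Rightarrow> ('g \<Rightarrow> 'k point \<Rightarrow> 'k point) \<Rightarrow> 'g set \<Rightarrow>
     nat \<Rightarrow> 'k point set \<Rightarrow> ('k point \<Rightarrow> 'k point) \<Rightarrow> bool" where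
  "quotient_curve N Z act A M X \<pi> \<longleftrightarrow>
     smooth_projective_curve M X \<and> is_morphism N Z M X \<pi> \<and> \<pi> ` Z = X \<and>
     (\<forall>z\<in>Z. \<forall>z'\<in>Z. \<pi> z = \<pi> z' \<longleftrightarrow> (\<exists>a\<in>A. z' = act a z)) \<and>
     (\<forall>U\<subseteq>X. zariski_open_in M X U \<longleftrightarrow> zariski_open_in N Z {z\<in>Z. \<pi> z \<in> U}) \<and>
     (\<forall>U f. zariski_open_in M X U \<and> regular_function N {z\<in>Z. \<pi> z \<in> U} f \<and>
            (\<forall>a\<in>A. \<forall>z\<in>Z. \<pi> z \<in> U \<longrightarrow> f (act a z) = f z) \<longrightarrow>
            (\<exists>f'. regular_function M U f' \<and> (\<forall>z\<in>Z. \<pi> z \<in> U \<longrightarrow> f z = f' (\<pi> z))))"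

definition rep_dim :: "'g monoid \<Rightarrow> ('g \<Rightarrow> 'a mat) \<Rightarrow> nat" where
  "rep_dim G \<rho> = dim_row (\<rho> \<one>\<^bsub>G\<^esub>)"

definition representation :: "'g monoid \<Rightarrow> ('g \<Rightarrow> 'a::field mat) \<Rightarrow> bool" where
  "representation G \<rho> \<longleftrightarrow>
     (\<forall>g\<in>carrier G. \<rho> g \<in> carrier_mat (rep_dim G \<rho>) (rep_dim G \<rho>)) \<and>
     \<rho> \<one>\<^bsub>G\<^esub> = 1\<^sub>m (rep_dim G \<rho>) \<and>
     (\<forall>g\<in>carrier G. \<forall>h\<in>carrier G. \<rho> (g \<otimes>\<^bsub>G\<^esub> h) = \<rho> g * \<rho> h)"

definition irreducible_rep :: "'g monoid \<Rightarrow> ('g \<Rightarrow> 'a::field mat) \<Rightarrow> bool" where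
  "irreducible_rep G \<rho> \<longleftrightarrow> representation G \<rho> \<and> rep_dim G \<rho> > 0 \<and>
     (\<forall>U. VectorSpace.subspace class_ring U (module_vec TYPE('a) (rep_dim G \<rho>)) \<and>
          (\<forall>g\<in>carrier G. \<forall>u\<in>U. \<rho> g *\<^sub>v u \<in> U) \<longrightarrow>
          U = {0\<^sub>v (rep_dim G \<rho>)} \<or> U = carrier_vec (rep_dim G \<rho>))"

definition rep_iso :: "'g monoid \<Rightarrow> ('g \<Rightarrow> 'a::field mat) \<Rightarrow> ('g \<Rightarrow> 'a mat) \<Rightarrow> bool" where
  "rep_iso G \<rho> \<sigma> \<longleftrightarrow> rep_dim G \<rho> = rep_dim G \<sigma> \<and>
     (\<exists>P \<in> carrier_mat (rep_dim G \<rho>) (rep_dim G \<rho>). invertible_mat P \<and>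
        (\<forall>g\<in>carrier G. P * \<rho> g = \<sigma> g * P))"

definition trivial_rep :: "'g \<Rightarrow> 'a::field mat" where
  "trivial_rep g = 1\<^sub>m 1"

definition rep_character :: "('g \<Rightarrow> 'a::field mat) \<Rightarrow> 'g \<Rightarrow> 'a" where
  "rep_character \<rho> g = (\<Sum>i<dim_row (\<rho> g). \<rho> g $$ (i, i))"

definition fixed_dim :: "'g monoid \<Rightarrow> ('g \<Rightarrow> 'a::field mat) \<Rightarrow> 'g set \<Rightarrow> nat" where
  "fixed_dim G \<rho> N =
     subspace_dim (rep_dim G \<rho>) {v \<in> carrier_vec (rep_dim G \<rho>). \<forall>h\<in>N. \<rho> h *\<^sub>v v = v}"

definition character_field :: "'g monoid \<Rightarrow> ('g \<Rightarrow> complex mat) \<Rightarrow> complex set" where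
  "character_field G V = generate_field class_ring (rep_character V ` carrier G)"

text \<open>Automorphisms of a subfield \<open>L\<close> of the complex numbers; they automatically fix the rationals.\<close>

definition galois_group :: "complex set \<Rightarrow> (complex \<Rightarrow> complex) set" where
  "galois_group L = {\<tau> \<in> extensional L.
     \<tau> \<in> ring_iso (class_ring\<lparr>carrier := L\<rparr>) (class_ring\<lparr>carrier := L\<rparr>)}"

text \<open>
  The trace from \<open>L\<close> to the rationals, for \<open>L\<close> a finite Galois extension of the rationals.  It is used
  for character fields only, and these are subfields of cyclotomic fields, hence Galois.
\<close>

definition galois_trace :: "complex set \<Rightarrow> complex \<Rightarrow> complex" where
  "galois_trace L x = (\<Sum>\<tau>\<in>galois_group L. \<tau> x)"

text \<open>
  \<open>V\<^sup>\<tau>\<close> is obtained by applying to the matrix entries an extension of \<open>\<tau>\<close> to an automorphism of the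
  complex numbers; for \<open>\<tau>\<close> in the Galois group of the character field of \<open>V\<close>, its isomorphism class
  does not depend on the extension.
\<close>

definition is_galois_conjugate ::
    "complex set \<Rightarrow> (complex \<Rightarrow> complex) \<Rightarrow> ('g \<Rightarrow> complex mat) \<Rightarrow> ('g \<Rightarrow> complex mat) \<Rightarrow> bool" where
  "is_galois_conjugate L \<tau> V V' \<longleftrightarrow>
     (\<exists>s. s \<in> ring_iso class_ring class_ring \<and> (\<forall>x\<in>L. s x = \<tau> x) \<and> V' = (\<lambda>g. map_mat s (V g)))"

definition realizable_over :: "'g monoid \<Rightarrow> complex set \<Rightarrow> ('g \<Rightarrow> complex mat) \<Rightarrow> bool" where
  "realizable_over G F V \<longleftrightarrow> (\<exists>\<rho>. representation G \<rho> \<and> rep_iso G V \<rho> \<and>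
     (\<forall>g\<in>carrier G. \<forall>i<rep_dim G \<rho>. \<forall>j<rep_dim G \<rho>. \<rho> g $$ (i, j) \<in> F))"

definition schur_index :: "'g monoid \<Rightarrow> ('g \<Rightarrow> complex mat) \<Rightarrow> nat" where
  "schur_index G V = (LEAST m. \<exists>F. subfield F class_ring \<and> character_field G V \<subseteq> F \<and>
     ring.dimension class_ring m (character_field G V) F \<and> realizable_over G F V)"

definition complexification :: "('g \<Rightarrow> rat mat) \<Rightarrow> 'g \<Rightarrow> complex mat" where
  "complexification W g = map_mat of_rat (W g)"

definition associated_complex_rep ::
    "'g monoid \<Rightarrow> ('g \<Rightarrow> rat mat) \<Rightarrow> ('g \<Rightarrow> complex mat) \<Rightarrow> bool" where
  "associated_complex_rep G W V \<longleftrightarrow> irreducible_rep G V \<and>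
     (\<exists>\<tau>s C. distinct \<tau>s \<and> set \<tau>s = galois_group (character_field G V) \<and>
        (\<forall>\<tau>\<in>set \<tau>s. is_galois_conjugate (character_field G V) \<tau> V (C \<tau>)) \<and>
        rep_iso G (complexification W)
          (\<lambda>g. diag_block_mat (concat (replicate (schur_index G V) (map (\<lambda>\<tau>. C \<tau> g) \<tau>s)))))"

text \<open>
  \<open>g i j\<close> (\<open>1 \<le> i \<le> d\<close>, \<open>1 \<le> j \<le> nn i\<close>) represent both the left and the right cosets of \<open>H\<close>, arranged
  by double cosets; the first double coset is \<open>H\<close> itself since \<open>g 1 1 = \<one>\<close>.
\<close>

definition double_coset_reps ::
    "'g monoid \<Rightarrow> 'g set \<Rightarrow> nat \<Rightarrow> (nat \<Rightarrow> nat) \<Rightarrow> (nat \<Rightarrow> nat \<Rightarrow> 'g) \<Rightarrow> bool" where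
  "double_coset_reps G H d nn g \<longleftrightarrow>
     1 \<le> d \<and> g 1 1 = \<one>\<^bsub>G\<^esub> \<and>
     (\<forall>i\<in>{1..d}. 1 \<le> nn i \<and> (\<forall>j\<in>{1..nn i}. g i j \<in> carrier G)) \<and>
     disjoint_family_on (\<lambda>i. (H #>\<^bsub>G\<^esub> g i 1) <#>\<^bsub>G\<^esub> H) {1..d} \<and>
     (\<Union>i\<in>{1..d}. (H #>\<^bsub>G\<^esub> g i 1) <#>\<^bsub>G\<^esub> H) = carrier G \<and>
     (\<forall>i\<in>{1..d}.
        disjoint_family_on (\<lambda>j. g i j <#\<^bsub>G\<^esub> H) {1..nn i} \<and>
        (\<Union>j\<in>{1..nn i}. g i j <#\<^bsub>G\<^esub> H) = (H #>\<^bsub>G\<^esub> g i 1) <#>\<^bsub>G\<^esub> H \<and>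
        disjoint_family_on (\<lambda>j. H #>\<^bsub>G\<^esub> g i j) {1..nn i} \<and>
        (\<Union>j\<in>{1..nn i}. H #>\<^bsub>G\<^esub> g i j) = (H #>\<^bsub>G\<^esub> g i 1) <#>\<^bsub>G\<^esub> H)"

definition a_coeff ::
    "'g monoid \<Rightarrow> 'g set \<Rightarrow> complex set \<Rightarrow> ('g \<Rightarrow> complex mat) \<Rightarrow> 'g \<Rightarrow> int" where
  "a_coeff G H L V g = (THE a. of_int a =
     (\<Sum>h\<in>H. galois_trace L (rep_character V (h \<otimes>\<^bsub>G\<^esub> inv\<^bsub>G\<^esub> g))))"

definition b_coeff ::
    "'g monoid \<Rightarrow> 'g set \<Rightarrow> complex set \<Rightarrow> nat \<Rightarrow> (nat \<Rightarrow> 'g \<Rightarrow> complex mat) \<Rightarrow>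
     (nat \<Rightarrow> nat \<Rightarrow> 'g) \<Rightarrow> nat \<Rightarrow> int" where
  "b_coeff G H L r V g i = (\<Sum>k=1..r. a_coeff G H L (V k) (g i 1))"

definition b_gcd :: "nat \<Rightarrow> (nat \<Rightarrow> int) \<Rightarrow> int" where
  "b_gcd d b = Gcd {b 1 - b i | i. 2 \<le> i \<and> i \<le> d}"

text \<open>
  A correspondence is described by the map \<open>x \<mapsto> D(x)\<close>.  Rational coefficients are allowed since the
  Kanev correspondence is defined with denominators; the divisor group is torsion free, so an identity
  between integral correspondences may be tested there.
\<close>

type_synonym 'p divisor = "'p \<Rightarrow>\<^sub>0 rat"
type_synonym 'p corr = "'p \<Rightarrow> 'p divisor"

definition div_scale :: "rat \<Rightarrow> 'p divisor \<Rightarrow> 'p divisor" where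
  "div_scale c D = Poly_Mapping.map ((*) c) D"

definition div_degree :: "'p divisor \<Rightarrow> rat" where
  "div_degree D = (\<Sum>y\<in>Poly_Mapping.keys D. Poly_Mapping.lookup D y)"

definition corr_add :: "'p corr \<Rightarrow> 'p corr \<Rightarrow> 'p corr"  (infixl \<open>+\<^sub>c\<close> 65) where
  "D +\<^sub>c E = (\<lambda>x. D x + E x)"

definition corr_scale :: "rat \<Rightarrow> 'p corr \<Rightarrow> 'p corr"  (infixr \<open>\<cdot>\<^sub>c\<close> 75) where
  "c \<cdot>\<^sub>c D = (\<lambda>x. div_scale c (D x))"

definition corr_diff :: "'p corr \<Rightarrow> 'p corr \<Rightarrow> 'p corr"  (infixl \<open>-\<^sub>c\<close> 65) where
  "D -\<^sub>c E = (\<lambda>x. D x - E x)"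

text \<open>\<open>(D \<circ> E)(x) = D(E(x))\<close>, with \<open>D\<close> extended linearly to divisors.\<close>

definition corr_comp :: "'p corr \<Rightarrow> 'p corr \<Rightarrow> 'p corr"  (infixl \<open>\<circ>\<^sub>c\<close> 70) where
  "D \<circ>\<^sub>c E = (\<lambda>x. \<Sum>y\<in>Poly_Mapping.keys (E x). div_scale (Poly_Mapping.lookup (E x) y) (D y))"

definition corr_diag :: "'p corr"  (\<open>\<Delta>\<^sub>c\<close>) where
  "\<Delta>\<^sub>c = (\<lambda>x. Poly_Mapping.single x 1)"

definition corr_degree :: "'p set \<Rightarrow> 'p corr \<Rightarrow> rat" where
  "corr_degree X D = (THE m. \<forall>x\<in>X. div_degree (D x) = m)"

text \<open>
  \<open>x \<mapsto> \<Sum>\<^sub>i c\<^sub>i \<Sum>\<^sub>j \<pi>(g\<^sub>i\<^sub>j z)\<close> for a preimage \<open>z\<close> of \<open>x\<close>.  The choice of \<open>z\<close> is immaterial because the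
  \<open>g i j\<close> represent the left and the right cosets simultaneously.
\<close>

definition coset_corr ::
    "'p set \<Rightarrow> ('g \<Rightarrow> 'p \<Rightarrow> 'p) \<Rightarrow> ('p \<Rightarrow> 'p) \<Rightarrow> nat \<Rightarrow> (nat \<Rightarrow> nat) \<Rightarrow> (nat \<Rightarrow> nat \<Rightarrow> 'g) \<Rightarrow>
     (nat \<Rightarrow> int) \<Rightarrow> 'p corr" where
  "coset_corr Z act \<pi> d nn g c = (\<lambda>x. let z = (SOME z. z \<in> Z \<and> \<pi> z = x) in
     \<Sum>i=1..d. div_scale (of_int (c i)) (\<Sum>j=1..nn i. Poly_Mapping.single (\<pi> (act (g i j) z)) 1))"

text \<open>
  The trace correspondence \<open>x \<mapsto> \<phi>\<^sub>H\<^sup>*\<phi>\<^sub>H(x)\<close> of \<open>X = Z/H\<close> over \<open>Y = Z/G\<close>, through its expression as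
  \<open>\<Sum>\<^sub>i\<^sub>j \<pi>\<^sub>H(g\<^sub>i\<^sub>j z)\<close>, in which ramification multiplicities appear as repeated summands.
\<close>

definition trace_corr ::
    "'p set \<Rightarrow> ('g \<Rightarrow> 'p \<Rightarrow> 'p) \<Rightarrow> ('p \<Rightarrow> 'p) \<Rightarrow> nat \<Rightarrow> (nat \<Rightarrow> nat) \<Rightarrow> (nat \<Rightarrow> nat \<Rightarrow> 'g) \<Rightarrow> 'p corr" where
  "trace_corr Z act \<pi> d nn g = coset_corr Z act \<pi> d nn g (\<lambda>i. 1)"

definition kanev_corr ::
    "'p set \<Rightarrow> ('g \<Rightarrow> 'p \<Rightarrow> 'p) \<Rightarrow> ('p \<Rightarrow> 'p) \<Rightarrow> nat \<Rightarrow> (nat \<Rightarrow> nat) \<Rightarrow> (nat \<Rightarrow> nat \<Rightarrow> 'g) \<Rightarrow>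
     (nat \<Rightarrow> int) \<Rightarrow> 'p corr" where
  "kanev_corr Z act \<pi> d nn g b =
     \<Delta>\<^sub>c -\<^sub>c (1 / of_int (b_gcd d b)) \<cdot>\<^sub>c coset_corr Z act \<pi> d nn g b
        +\<^sub>c (of_int (b 1) / of_int (b_gcd d b) - 1) \<cdot>\<^sub>c trace_corr Z act \<pi> d nn g"

end

(*
  On functions on G, composition of correspondences of the form \<pi> z \<mapsto> \<Sum>\<^sub>g f(g) \<pi>(g z) is convolution.
  The coefficients b_i are the values of \<beta>(g) = \<Sum>\<^sub>h \<psi>(h g\<^sup>-\<^sup>1), where h runs over H and \<psi> is the sum of
  the Galois conjugates of the characters of V_1, ..., V_r.  These conjugates are pairwise distinct, nontrivial
  and irreducible of degree n, so \<psi> * \<psi> = (|G|/n) \<psi> and \<psi> has sum 0; hence D\<^sup>2 = (|G|/n) D for the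
  correspondence D with coefficients b_i, and D is annihilated by the trace correspondence T.  Therefore
  (K - \<Delta>)(K + (q - 1) \<Delta>) is a multiple of T, and T K = deg K \<cdot> T.
  The number q is an integer because it is a rational eigenvalue of the integral correspondence
  (D - b_1 T)/b.  Moreover b is nonzero: otherwise \<beta> would be constant with sum 0, whereas dim V^H = 1 forces
  \<beta>(1) > 0.
*)
theory Submission
  imports Defs "Jordan_Normal_Form.Spectral_Radius"
begin

section \<open>Schur's lemma\<close>

text \<open>The relation for \<open>\<psi> * \<psi>\<close> covers two situations. Within one k the
  conjugates of V_k are compared over the complex numbers: Schur's lemma gives the scalar |G|/n, and
  different conjugates are orthogonal because their characters differ. For k \<noteq> l it is the
  rational representations that are known to be non-isomorphic. The vanishing half of Schur's lemma
  holds over every field of characteristic 0, so it is applied to W_k and W_l over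
  \<open>rat\<close> and carried over by the fact that the character of W_k is a positive multiple
  of the sum of conjugate characters. The same fact makes this sum rational; being also a sum of
  roots of unity, it is an integer, and this gives the definite description \<open>a_coeff\<close> a
  value. Functions live on G and not on cosets, so each coset of H is counted |H| times. This is the
  origin of all factors |H|: a coset correspondence with coefficients f is represented by f/|H|, and
  the diagonal by the indicator of H divided by |H|, which acts as a unit on H-invariant
  functions.\<close>

locale finite_group = group G for G :: "'g monoid" (structure) +
  assumes fin: "finite (carrier G)"
begin

lemma sum_inv: "(\<Sum>g\<in>carrier G. f (inv g)) = (\<Sum>g\<in>carrier G. f g)"
  by (rule sum.reindex_bij_witness[of _ "\<lambda>g. inv g" "\<lambda>g. inv g"]) auto

lemma sum_mult_left:
  assumes "x \<in> carrier G"
  shows "(\<Sum>g\<in>carrier G. f (x \<otimes> g)) = (\<Sum>g\<in>carrier G. f g)"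
  by (rule sum.reindex_bij_witness[of _ "\<lambda>g. inv x \<otimes> g" "\<lambda>g. x \<otimes> g"])
    (use assms in \<open>auto simp: m_assoc[symmetric]\<close>)

lemma sum_mult_right:
  assumes "x \<in> carrier G"
  shows "(\<Sum>g\<in>carrier G. f (g \<otimes> x)) = (\<Sum>g\<in>carrier G. f g)"
  by (rule sum.reindex_bij_witness[of _ "\<lambda>g. g \<otimes> inv x" "\<lambda>g. g \<otimes> x"])
    (use assms in \<open>auto simp: m_assoc\<close>)

end

section \<open>Invariant subspaces and intertwiners\<close>

lemma representationD:
  assumes "representation G \<rho>"
  shows "g \<in> carrier G \<Longrightarrow> \<rho> g \<in> carrier_mat (rep_dim G \<rho>) (rep_dim G \<rho>)"
    and "\<rho> \<one>\<^bsub>G\<^esub> = 1\<^sub>m (rep_dim G \<rho>)"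
    and "g \<in> carrier G \<Longrightarrow> h \<in> carrier G \<Longrightarrow> \<rho> (g \<otimes>\<^bsub>G\<^esub> h) = \<rho> g * \<rho> h"
  using assms unfolding representation_def by auto

lemma irreducible_repD:
  assumes "irreducible_rep G \<rho>"
  shows "representation G \<rho>" "rep_dim G \<rho> > 0"
  using assms unfolding irreducible_rep_def by auto

lemma vec_subspaceI:
  fixes U :: "'a::field vec set"
  assumes "U \<subseteq> carrier_vec n" "0\<^sub>v n \<in> U"
    and "\<And>u v. u \<in> U \<Longrightarrow> v \<in> U \<Longrightarrow> u + v \<in> U" and "\<And>c v. v \<in> U \<Longrightarrow> c \<cdot>\<^sub>v v \<in> U"
  shows "VectorSpace.subspace class_ring U (module_vec TYPE('a) n)"
  by (intro VectorSpace.subspace.intro submodule.intro vec_vs vec_module)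
    (use assms in \<open>auto simp: module_vec_simps\<close>)

lemma irreducible_rep_subspace:
  fixes \<rho> :: "'g \<Rightarrow> 'a::field mat"
  assumes "irreducible_rep G \<rho>"
    and "U \<subseteq> carrier_vec (rep_dim G \<rho>)" "0\<^sub>v (rep_dim G \<rho>) \<in> U"
    and "\<And>u v. u \<in> U \<Longrightarrow> v \<in> U \<Longrightarrow> u + v \<in> U" and "\<And>c v. v \<in> U \<Longrightarrow> c \<cdot>\<^sub>v v \<in> U"
    and "\<And>g u. g \<in> carrier G \<Longrightarrow> u \<in> U \<Longrightarrow> \<rho> g *\<^sub>v u \<in> U"
  shows "U = {0\<^sub>v (rep_dim G \<rho>)} \<or> U = carrier_vec (rep_dim G \<rho>)"
  using assms vec_subspaceI[OF assms(2-5)] unfolding irreducible_rep_def by blast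

lemma mult_unit_vec_eq_col:
  fixes T :: "'a::comm_semiring_1 mat"
  assumes "T \<in> carrier_mat a b" "j < b"
  shows "T *\<^sub>v unit_vec b j = col T j"
  using assms by (intro eq_vecI) (auto simp: scalar_prod_right_unit)

lemma mult_vec_zero_imp_zero_mat:
  fixes T :: "'a::comm_semiring_1 mat"
  assumes T: "T \<in> carrier_mat a b" and z: "\<And>v. v \<in> carrier_vec b \<Longrightarrow> T *\<^sub>v v = 0\<^sub>v a"
  shows "T = 0\<^sub>m a b"
proof (rule eq_matI)
  fix i j assume "i < dim_row (0\<^sub>m a b)" "j < dim_col (0\<^sub>m a b)"
  then have ij: "i < a" "j < b" by auto
  have "col T j = 0\<^sub>v a" using z[of "unit_vec b j"] mult_unit_vec_eq_col[OF T ij(2)] by simp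
  then have "col T j $ i = 0" using ij by simp
  then show "T $$ (i, j) = 0\<^sub>m a b $$ (i, j)" using T ij by auto
qed (use T in auto)

text \<open>The kernel of T is an invariant subspace, and it is not everything because T is nonzero.
  Irreducibility is asked of the source alone, so the target may be a Galois conjugate whose
  irreducibility has not been established.\<close>

lemma intertwiner_injective:
  fixes T :: "'a::field mat"
  assumes irr: "irreducible_rep G \<sigma>" and T: "T \<in> carrier_mat a (rep_dim G \<sigma>)"
    and \<rho>: "\<And>x. x \<in> carrier G \<Longrightarrow> \<rho> x \<in> carrier_mat a a"
    and int: "\<And>x. x \<in> carrier G \<Longrightarrow> \<rho> x * T = T * \<sigma> x"
    and nz: "T \<noteq> 0\<^sub>m a (rep_dim G \<sigma>)"
    and v: "v \<in> carrier_vec (rep_dim G \<sigma>)" "T *\<^sub>v v = 0\<^sub>v a"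
  shows "v = 0\<^sub>v (rep_dim G \<sigma>)"
proof -
  let ?b = "rep_dim G \<sigma>"
  define U where "U = {v \<in> carrier_vec ?b. T *\<^sub>v v = 0\<^sub>v a}"
  note \<sigma> = representationD(1)[OF irreducible_repD(1)[OF irr]]
  have "T *\<^sub>v (\<sigma> g *\<^sub>v u) = 0\<^sub>v a" if "g \<in> carrier G" "u \<in> U" for g u
  proof -
    have u: "u \<in> carrier_vec ?b" "T *\<^sub>v u = 0\<^sub>v a" using that by (auto simp: U_def)
    have "T *\<^sub>v (\<sigma> g *\<^sub>v u) = (T * \<sigma> g) *\<^sub>v u" using T \<sigma>[OF that(1)] u by simp
    also have "\<dots> = \<rho> g *\<^sub>v (T *\<^sub>v u)" using int[OF that(1)] T \<rho>[OF that(1)] u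
      by (metis assoc_mult_mat_vec)
    also have "\<dots> = 0\<^sub>v a" using \<rho>[OF that(1)] u(2) by auto
    finally show ?thesis .
  qed
  then have "U = {0\<^sub>v ?b} \<or> U = carrier_vec ?b"
    using T \<sigma> by (intro irreducible_rep_subspace[OF irr])
      (auto simp: U_def mult_add_distrib_mat_vec[of _ a ?b] mult_mat_vec[of _ a ?b] intro!: mult_mat_vec_carrier)
  moreover have "U \<noteq> carrier_vec ?b"
    using mult_vec_zero_imp_zero_mat[OF T] nz by (auto simp: U_def)
  ultimately show ?thesis using v by (auto simp: U_def)
qed

text \<open>Dual to the injective case: the image of T is nonzero and invariant under the
  irreducible target.\<close>

lemma intertwiner_surjective:
  fixes T :: "'a::field mat"
  assumes irr: "irreducible_rep G \<rho>" and T: "T \<in> carrier_mat (rep_dim G \<rho>) b"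
    and \<sigma>: "\<And>x. x \<in> carrier G \<Longrightarrow> \<sigma> x \<in> carrier_mat b b"
    and int: "\<And>x. x \<in> carrier G \<Longrightarrow> \<rho> x * T = T * \<sigma> x"
    and nz: "T \<noteq> 0\<^sub>m (rep_dim G \<rho>) b"
    and w: "w \<in> carrier_vec (rep_dim G \<rho>)"
  shows "\<exists>v\<in>carrier_vec b. T *\<^sub>v v = w"
proof -
  let ?a = "rep_dim G \<rho>"
  define U where "U = (\<lambda>v. T *\<^sub>v v) ` carrier_vec b"
  note \<rho> = representationD(1)[OF irreducible_repD(1)[OF irr]]
  have "U = {0\<^sub>v ?a} \<or> U = carrier_vec ?a"
  proof (rule irreducible_rep_subspace[OF irr])
    show "U \<subseteq> carrier_vec ?a" using T by (auto simp: U_def intro!: mult_mat_vec_carrier)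
    show "0\<^sub>v ?a \<in> U" using T unfolding U_def by (intro image_eqI[of _ _ "0\<^sub>v b"]) auto
    fix u v assume "u \<in> U" "v \<in> U"
    then obtain u' v' where "u = T *\<^sub>v u'" "v = T *\<^sub>v v'" "u' \<in> carrier_vec b" "v' \<in> carrier_vec b"
      unfolding U_def by blast
    then show "u + v \<in> U" unfolding U_def using T
      by (intro image_eqI[of _ _ "u' + v'"]) (auto simp: mult_add_distrib_mat_vec[of _ ?a b])
  next
    fix c v assume "v \<in> U"
    then obtain v' where "v = T *\<^sub>v v'" "v' \<in> carrier_vec b" unfolding U_def by blast
    then show "c \<cdot>\<^sub>v v \<in> U" unfolding U_def using T
      by (intro image_eqI[of _ _ "c \<cdot>\<^sub>v v'"]) (auto simp: mult_mat_vec[of _ ?a b])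
  next
    fix g v assume g: "g \<in> carrier G" and "v \<in> U"
    then obtain v' where v: "v = T *\<^sub>v v'" "v' \<in> carrier_vec b" unfolding U_def by blast
    have "\<rho> g *\<^sub>v v = (\<rho> g * T) *\<^sub>v v'" using v T \<rho>[OF g] by simp
    also have "\<dots> = T *\<^sub>v (\<sigma> g *\<^sub>v v')" using int[OF g] T \<sigma>[OF g] v by simp
    finally show "\<rho> g *\<^sub>v v \<in> U" unfolding U_def using \<sigma>[OF g] v(2)
      by (intro image_eqI[of _ _ "\<sigma> g *\<^sub>v v'"]) auto
  qed
  moreover have "U \<noteq> {0\<^sub>v ?a}"
    using mult_vec_zero_imp_zero_mat[OF T] nz by (auto simp: U_def)
  ultimately show ?thesis using w unfolding U_def by (metis imageE)
qed

lemma square_injective_invertible: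
  fixes T :: "'a::field mat"
  assumes T: "T \<in> carrier_mat n n"
    and inj: "\<And>v. v \<in> carrier_vec n \<Longrightarrow> T *\<^sub>v v = 0\<^sub>v n \<Longrightarrow> v = 0\<^sub>v n"
  obtains S where "S \<in> carrier_mat n n" "T * S = 1\<^sub>m n" "S * T = 1\<^sub>m n"
proof -
  have "det T \<noteq> 0" using det_0_iff_vec_prod_zero_field[OF T] inj by blast
  from det_non_zero_imp_unit[OF T this, of "()"] show ?thesis
    using that unfolding Units_def ring_mat_def by auto
qed

section \<open>Matrix traces\<close>

definition mat_trace :: "'a::comm_monoid_add mat \<Rightarrow> 'a" where
  "mat_trace A = (\<Sum>i<dim_row A. A $$ (i, i))"

lemma rep_character_eq_trace: "rep_character \<rho> g = mat_trace (\<rho> g)"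
  by (simp add: rep_character_def mat_trace_def)

lemma mat_trace_one: "mat_trace (1\<^sub>m n :: 'a::semiring_1 mat) = of_nat n"
  by (simp add: mat_trace_def)

lemma mat_mult_index:
  assumes "A \<in> carrier_mat a b" "B \<in> carrier_mat b c" "i < a" "j < c"
  shows "(A * B) $$ (i, j) = (\<Sum>k<b. A $$ (i, k) * B $$ (k, j))"
  using assms by (auto simp: scalar_prod_def atLeast0LessThan)

lemma mat_trace_comm:
  fixes A :: "'a::comm_semiring_0 mat"
  assumes A: "A \<in> carrier_mat a b" and B: "B \<in> carrier_mat b a"
  shows "mat_trace (A * B) = mat_trace (B * A)"
proof -
  have "mat_trace (A * B) = (\<Sum>i<a. \<Sum>k<b. A $$ (i, k) * B $$ (k, i))"
    unfolding mat_trace_def using A mat_mult_index[OF A B] by simp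
  also have "\<dots> = (\<Sum>k<b. \<Sum>i<a. B $$ (k, i) * A $$ (i, k))"
    by (subst sum.swap) (simp add: mult.commute)
  also have "\<dots> = mat_trace (B * A)"
    unfolding mat_trace_def using B mat_mult_index[OF B A] by simp
  finally show ?thesis .
qed

lemma mat_trace_conj:
  fixes A :: "'a::field mat"
  assumes A: "A \<in> carrier_mat n n" and B: "B \<in> carrier_mat n n"
    and P: "P \<in> carrier_mat n n" and Q: "Q \<in> carrier_mat n n"
    and QP: "Q * P = 1\<^sub>m n" and PA: "P * A = B * P"
  shows "mat_trace A = mat_trace B"
proof -
  have PQ: "P * Q = 1\<^sub>m n" using mat_mult_left_right_inverse[OF Q P QP] .
  have "A = Q * (P * A)" using assoc_mult_mat[OF Q P A] QP A by simp
  then have "mat_trace A = mat_trace (Q * (B * P))" using PA by simp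
  also have "\<dots> = mat_trace ((B * P) * Q)" using Q B P by (intro mat_trace_comm) auto
  also have "(B * P) * Q = B" using assoc_mult_mat[OF B P Q] PQ B by simp
  finally show ?thesis .
qed

text \<open>Traces count dimensions: preimages of the unit vectors form a right inverse S,
  injectivity makes it a left inverse, and then a = tr(T S) = tr(S T) = b, which is where
  characteristic 0 enters.\<close>

lemma bijective_mat_square:
  fixes T :: "'a::field_char_0 mat"
  assumes T: "T \<in> carrier_mat a b"
    and inj: "\<And>v. v \<in> carrier_vec b \<Longrightarrow> T *\<^sub>v v = 0\<^sub>v a \<Longrightarrow> v = 0\<^sub>v b"
    and surj: "\<And>w. w \<in> carrier_vec a \<Longrightarrow> \<exists>v\<in>carrier_vec b. T *\<^sub>v v = w"
  shows "a = b"
proof -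
  have "\<forall>j. \<exists>v. j < a \<longrightarrow> v \<in> carrier_vec b \<and> T *\<^sub>v v = unit_vec a j"
    using surj by (metis unit_vec_carrier)
  then obtain s where s: "\<And>j. j < a \<Longrightarrow> s j \<in> carrier_vec b \<and> T *\<^sub>v s j = unit_vec a j" by metis
  define S where "S = mat_of_cols b (map s [0..<a])"
  have S: "S \<in> carrier_mat b a" by (auto simp: S_def)
  have cS: "col S j = s j" if "j < a" for j using s that by (auto simp: S_def)
  have TS: "T * S = 1\<^sub>m a"
  proof (rule mat_col_eqI)
    fix j assume j: "j < dim_col (1\<^sub>m a)"
    then have "col (T * S) j = T *\<^sub>v col S j" using T S by (intro col_mult2) auto
    then show "col (T * S) j = col (1\<^sub>m a) j" using cS s j by auto
  qed (use T S in auto)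
  have "S * T = 1\<^sub>m b"
  proof (rule mat_col_eqI)
    fix j assume "j < dim_col (1\<^sub>m b)"
    then have j: "j < b" by simp
    let ?e = "unit_vec b j" and ?w = "(S * T) *\<^sub>v unit_vec b j"
    have "T *\<^sub>v ?w = (T * S) *\<^sub>v (T *\<^sub>v ?e)" using T S
      by (simp add: assoc_mult_mat_vec[of _ b a _ b] assoc_mult_mat_vec[of _ a b _ a])
    then have "T *\<^sub>v ?w = T *\<^sub>v ?e" using TS T by auto
    then have "T *\<^sub>v (?w - ?e) = 0\<^sub>v a" using T S
      by (subst mult_minus_distrib_mat_vec[of _ a b]) auto
    moreover have w: "?w \<in> carrier_vec b" using S T by auto
    ultimately have "?w - ?e = 0\<^sub>v b" by (intro inj) auto
    then have "?w = ?e" using w S by (auto simp: vec_eq_iff)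
    then show "col (S * T) j = col (1\<^sub>m b) j"
      using mult_unit_vec_eq_col[of "S * T" b b j] S T j by auto
  qed (use T S in auto)
  then have "of_nat a = (of_nat b :: 'a)"
    using mat_trace_comm[OF T S] TS by (simp add: mat_trace_one)
  then show ?thesis by simp
qed

section \<open>Orthogonality of characters\<close>

text \<open>Similar matrices have equal traces. The size of the matrices is asked at the single
  element g, since one application is to a block diagonal family that is not shown to be a
  homomorphism.\<close>

lemma rep_iso_character:
  fixes \<rho> \<sigma> :: "'g \<Rightarrow> 'a::field mat"
  assumes "rep_iso G \<rho> \<sigma>" and g: "g \<in> carrier G"
    and "\<rho> g \<in> carrier_mat (rep_dim G \<rho>) (rep_dim G \<rho>)" "\<sigma> g \<in> carrier_mat (rep_dim G \<sigma>) (rep_dim G \<sigma>)"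
  shows "rep_character \<rho> g = rep_character \<sigma> g"
proof -
  let ?n = "rep_dim G \<rho>"
  obtain P where P: "P \<in> carrier_mat ?n ?n" "invertible_mat P" "P * \<rho> g = \<sigma> g * P"
    using assms unfolding rep_iso_def by blast
  obtain Q where Q: "inverts_mat P Q" "inverts_mat Q P"
    using P(2) unfolding invertible_mat_def by auto
  \<comment> \<open>\<open>invertible_mat\<close> yields an inverse of unknown size; the size is
    read off from the two products.\<close>
  have "dim_col (P * Q) = ?n" "dim_col (Q * P) = dim_row Q"
    unfolding Q[unfolded inverts_mat_def] using P(1) by auto
  then have Qc: "Q \<in> carrier_mat ?n ?n" using P(1) by (intro carrier_matI) simp_all
  have "Q * P = 1\<^sub>m ?n" using Q(2) Qc by (simp add: inverts_mat_def)
  moreover have "\<sigma> g \<in> carrier_mat ?n ?n" using assms unfolding rep_iso_def by simp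
  ultimately show ?thesis unfolding rep_character_eq_trace
    using mat_trace_conj[OF assms(3) _ P(1) Qc _ P(3)] by blast
qed

text \<open>T is injective because its source \<open>\<sigma>\<close> is irreducible. Either
  alternative of the disjunction then makes T square: an irreducible target forces T to be onto,
  while a Galois conjugate comes with equal dimension at once.\<close>

lemma intertwiner_rep_iso:
  fixes \<rho> \<sigma> :: "'g \<Rightarrow> 'a::field_char_0 mat"
  assumes \<sigma>: "irreducible_rep G \<sigma>" and \<rho>: "representation G \<rho>"
    and irr: "irreducible_rep G \<rho> \<or> rep_dim G \<rho> = rep_dim G \<sigma>"
    and T: "T \<in> carrier_mat (rep_dim G \<rho>) (rep_dim G \<sigma>)" "T \<noteq> 0\<^sub>m (rep_dim G \<rho>) (rep_dim G \<sigma>)"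
    and int: "\<And>x. x \<in> carrier G \<Longrightarrow> \<rho> x * T = T * \<sigma> x"
  shows "rep_iso G \<sigma> \<rho>"
proof -
  let ?n = "rep_dim G \<sigma>"
  note r = representationD(1)[OF \<rho>]
  note s = representationD(1)[OF irreducible_repD(1)[OF \<sigma>]]
  note inj = intertwiner_injective[OF \<sigma> T(1) r int T(2)]
  have n: "rep_dim G \<rho> = ?n"
    using irr
  proof
    assume "irreducible_rep G \<rho>"
    from bijective_mat_square[OF T(1) inj intertwiner_surjective[OF this T(1) s int T(2)]]
    show ?thesis .
  qed
  note T' = T(1)[unfolded n]
  obtain S where "S \<in> carrier_mat ?n ?n" "T * S = 1\<^sub>m ?n" "S * T = 1\<^sub>m ?n"
    using square_injective_invertible[OF T' inj[unfolded n]] .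
  then have "invertible_mat T"
    using T' unfolding invertible_mat_def by (auto simp: inverts_mat_def)
  then show ?thesis unfolding rep_iso_def using n T' int by auto
qed

text \<open>Over the complex numbers T has an eigenvalue c; T minus the scalar c still commutes with
  V and kills an eigenvector, so it is zero.\<close>

lemma irreducible_commuting_scalar:
  fixes V :: "'g \<Rightarrow> complex mat"
  assumes V: "irreducible_rep G V" and T: "T \<in> carrier_mat (rep_dim G V) (rep_dim G V)"
    and com: "\<And>x. x \<in> carrier G \<Longrightarrow> V x * T = T * V x"
  obtains c where "T = c \<cdot>\<^sub>m 1\<^sub>m (rep_dim G V)"
proof -
  let ?n = "rep_dim G V"
  note v = representationD(1)[OF irreducible_repD(1)[OF V]]
  obtain c where "c \<in> spectrum T"
    using spectrum_non_empty[OF T irreducible_repD(2)[OF V]] by blast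
  then obtain u where u: "u \<in> carrier_vec ?n" "u \<noteq> 0\<^sub>v ?n" "T *\<^sub>v u = c \<cdot>\<^sub>v u"
    using T unfolding spectrum_def eigenvalue_def eigenvector_def by auto
  define S where "S = T - c \<cdot>\<^sub>m 1\<^sub>m ?n"
  have S: "S \<in> carrier_mat ?n ?n" using T by (auto simp: S_def)
  have "V x * S = S * V x" if "x \<in> carrier G" for x
    unfolding S_def using v[OF that] T com[OF that]
    by (simp add: mult_minus_distrib_mat[of _ ?n ?n _ ?n] minus_mult_distrib_mat[of _ ?n ?n _ _ ?n]
        mult_smult_distrib[of _ ?n ?n _ ?n] mult_smult_assoc_mat[of _ ?n ?n _ ?n])
  moreover have "(c \<cdot>\<^sub>m 1\<^sub>m ?n) *\<^sub>v u = c \<cdot>\<^sub>v u"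
    using u(1) by (intro eq_vecI) (auto simp: row_smult smult_scalar_prod_distrib[of _ ?n])
  then have "S *\<^sub>v u = 0\<^sub>v ?n" unfolding S_def using T u
    by (subst minus_mult_distrib_mat_vec[of _ ?n ?n]) auto
  ultimately have "S = 0\<^sub>m ?n ?n"
    using intertwiner_injective[OF V S v, of "\<lambda>x. x"] u by blast
  then have "T = c \<cdot>\<^sub>m 1\<^sub>m ?n" using T unfolding S_def
    by (intro eq_matI) (auto simp: mat_eq_iff)
  then show ?thesis using that by blast
qed

section \<open>Averaging over the group and orthogonality of matrix coefficients\<close>

context finite_group
begin

text \<open>T is the sum over g of \<open>\<rho> g * E * \<sigma> (inv g)\<close>, where E is the
  elementary matrix with entry 1 at (j, k). Multiplying by x merely permutes the summands.\<close>

lemma average_intertwines: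
  fixes \<rho> \<sigma> :: "'g \<Rightarrow> 'a::field mat"
  assumes \<rho>: "representation G \<rho>" and \<sigma>: "representation G \<sigma>"
    and j: "j < rep_dim G \<rho>" and k: "k < rep_dim G \<sigma>" and x: "x \<in> carrier G"
  defines "T \<equiv> mat (rep_dim G \<rho>) (rep_dim G \<sigma>)
    (\<lambda>(i, l). \<Sum>g\<in>carrier G. \<rho> g $$ (i, j) * \<sigma> (inv g) $$ (k, l))"
  shows "\<rho> x * T = T * \<sigma> x"
proof (rule eq_matI)
  let ?a = "rep_dim G \<rho>" and ?b = "rep_dim G \<sigma>"
  note r = representationD[OF \<rho>] and s = representationD[OF \<sigma>]
  have T: "T \<in> carrier_mat ?a ?b" by (simp add: T_def)
  fix i l assume "i < dim_row (T * \<sigma> x)" "l < dim_col (T * \<sigma> x)"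
  then have il: "i < ?a" "l < ?b" using T s(1)[OF x] by auto
  have "(\<rho> x * T) $$ (i, l) = (\<Sum>m<?a. \<rho> x $$ (i, m) * (\<Sum>g\<in>carrier G. \<rho> g $$ (m, j) * \<sigma> (inv g) $$ (k, l)))"
    using il by (subst mat_mult_index[OF r(1)[OF x] T]) (simp_all add: T_def)
  also have "\<dots> = (\<Sum>g\<in>carrier G. (\<Sum>m<?a. \<rho> x $$ (i, m) * \<rho> g $$ (m, j)) * \<sigma> (inv g) $$ (k, l))"
    unfolding sum_distrib_left sum_distrib_right by (subst sum.swap) (simp add: mult.assoc)
  also have "\<dots> = (\<Sum>g\<in>carrier G. \<rho> (x \<otimes> g) $$ (i, j) * \<sigma> (inv g) $$ (k, l))"
    using il j x by (intro sum.cong) (auto simp: r(3) mat_mult_index[OF r(1) r(1)])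
  \<comment> \<open>The inverse is rewritten so that the whole summand depends on g through
    \<open>x \<otimes> g\<close>.\<close>
  also have "\<dots> = (\<Sum>g\<in>carrier G. \<rho> (x \<otimes> g) $$ (i, j) * \<sigma> (inv (x \<otimes> g) \<otimes> x) $$ (k, l))"
    using x by (intro sum.cong) (auto simp: inv_mult_group m_assoc)
  also have "\<dots> = (\<Sum>g\<in>carrier G. \<rho> g $$ (i, j) * \<sigma> (inv g \<otimes> x) $$ (k, l))"
    by (rule sum_mult_left[OF x])
  also have "\<dots> = (\<Sum>g\<in>carrier G. \<rho> g $$ (i, j) * (\<Sum>m<?b. \<sigma> (inv g) $$ (k, m) * \<sigma> x $$ (m, l)))"
    using il k x by (intro sum.cong) (auto simp: s(3) mat_mult_index[OF s(1) s(1)])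
  also have "\<dots> = (\<Sum>m<?b. (\<Sum>g\<in>carrier G. \<rho> g $$ (i, j) * \<sigma> (inv g) $$ (k, m)) * \<sigma> x $$ (m, l))"
    unfolding sum_distrib_left sum_distrib_right by (subst sum.swap) (simp add: mult.assoc)
  also have "\<dots> = (T * \<sigma> x) $$ (i, l)"
    using il by (subst mat_mult_index[OF T s(1)[OF x]]) (simp_all add: T_def)
  finally show "(\<rho> x * T) $$ (i, l) = (T * \<sigma> x) $$ (i, l)" .
qed (use representationD(1)[OF \<rho> x] representationD(1)[OF \<sigma> x] in \<open>auto simp: T_def\<close>)

text \<open>A nonzero averaged matrix would be an isomorphism. The field is arbitrary of
  characteristic 0 because both rational and complex representations are paired this way.\<close>

lemma schur_orthogonality:
  fixes \<rho> \<sigma> :: "'g \<Rightarrow> 'a::field_char_0 mat"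
  assumes \<sigma>: "irreducible_rep G \<sigma>" and \<rho>: "representation G \<rho>"
    and irr: "irreducible_rep G \<rho> \<or> rep_dim G \<rho> = rep_dim G \<sigma>"
    and ni: "\<not> rep_iso G \<sigma> \<rho>"
    and "i < rep_dim G \<rho>" "j < rep_dim G \<rho>" "k < rep_dim G \<sigma>" "l < rep_dim G \<sigma>"
  shows "(\<Sum>g\<in>carrier G. \<rho> g $$ (i, j) * \<sigma> (inv g) $$ (k, l)) = 0"
proof -
  define T where "T = mat (rep_dim G \<rho>) (rep_dim G \<sigma>)
    (\<lambda>(i, l). \<Sum>g\<in>carrier G. \<rho> g $$ (i, j) * \<sigma> (inv g) $$ (k, l))"
  have "T = 0\<^sub>m (rep_dim G \<rho>) (rep_dim G \<sigma>)"
    using intertwiner_rep_iso[OF \<sigma> \<rho> irr, of T] ni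
      average_intertwines[OF \<rho> irreducible_repD(1)[OF \<sigma>] assms(6,7)]
    unfolding T_def by auto
  then have "T $$ (i, l) = 0" using assms by simp
  then show ?thesis using assms by (simp add: T_def)
qed

text \<open>The averaged matrix commutes with V, hence is a scalar c. Its trace determines c: n c is
  the sum over g of the (k, j) entries of \<open>V (inv g \<otimes> g)\<close>, which is |G| for j =
  k and 0 otherwise.\<close>

lemma schur_orthogonality_same:
  fixes V :: "'g \<Rightarrow> complex mat"
  assumes V: "irreducible_rep G V"
    and ijkl: "i < rep_dim G V" "j < rep_dim G V" "k < rep_dim G V" "l < rep_dim G V"
  shows "(\<Sum>g\<in>carrier G. V g $$ (i, j) * V (inv g) $$ (k, l)) =
    (if i = l \<and> j = k then of_nat (card (carrier G)) / of_nat (rep_dim G V) else 0)"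
proof -
  let ?n = "rep_dim G V"
  note v = representationD[OF irreducible_repD(1)[OF V]]
  define T where "T = mat ?n ?n
    (\<lambda>(i, l). \<Sum>g\<in>carrier G. V g $$ (i, j) * V (inv g) $$ (k, l))"
  have T: "T \<in> carrier_mat ?n ?n" by (simp add: T_def)
  have "V x * T = T * V x" if "x \<in> carrier G" for x
    using average_intertwines[OF irreducible_repD(1)[OF V] irreducible_repD(1)[OF V] ijkl(2,3) that]
    unfolding T_def .
  then obtain c where c: "T = c \<cdot>\<^sub>m 1\<^sub>m ?n" using irreducible_commuting_scalar[OF V T] by blast
  have "of_nat ?n * c = mat_trace T" using c by (simp add: mat_trace_def)
  also have "\<dots> = (\<Sum>i<?n. \<Sum>g\<in>carrier G. V (inv g) $$ (k, i) * V g $$ (i, j))"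
    by (simp add: mat_trace_def T_def mult.commute)
  also have "\<dots> = (\<Sum>g\<in>carrier G. V (inv g \<otimes> g) $$ (k, j))"
    using ijkl by (subst sum.swap, intro sum.cong refl, subst v(3)) (simp_all add: mat_mult_index[OF v(1) v(1)])
  also have "\<dots> = (\<Sum>g\<in>carrier G. if j = k then 1 else 0)"
    using ijkl v(2) by (intro sum.cong) auto
  also have "\<dots> = (if j = k then of_nat (card (carrier G)) else 0)" by simp
  finally have "c = (if j = k then of_nat (card (carrier G)) / of_nat ?n else 0)"
    using irreducible_repD(2)[OF V] by (auto simp: field_simps)
  moreover have "(\<Sum>g\<in>carrier G. V g $$ (i, j) * V (inv g) $$ (k, l)) = T $$ (i, l)"
    using ijkl by (simp add: T_def)
  ultimately show ?thesis using ijkl c by auto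
qed

text \<open>Splitting \<open>\<sigma> (inv g \<otimes> u)\<close> moves u out of the sum over g,
  which leaves the sums of matrix coefficients that Schur orthogonality evaluates.\<close>

lemma character_convolution_expand:
  fixes \<rho> \<sigma> :: "'g \<Rightarrow> 'a::field mat"
  assumes \<rho>: "representation G \<rho>" and \<sigma>: "representation G \<sigma>" and u: "u \<in> carrier G"
  shows "(\<Sum>g\<in>carrier G. rep_character \<rho> g * rep_character \<sigma> (inv g \<otimes> u)) =
    (\<Sum>i<rep_dim G \<rho>. \<Sum>k<rep_dim G \<sigma>. \<Sum>l<rep_dim G \<sigma>.
      (\<Sum>g\<in>carrier G. \<rho> g $$ (i, i) * \<sigma> (inv g) $$ (k, l)) * \<sigma> u $$ (l, k))"
proof -
  let ?a = "rep_dim G \<rho>" and ?b = "rep_dim G \<sigma>"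
  note r = representationD[OF \<rho>] and s = representationD[OF \<sigma>]
  have r': "rep_character \<rho> g = (\<Sum>i<?a. \<rho> g $$ (i, i))" if "g \<in> carrier G" for g
    using r(1)[OF that] by (auto simp: rep_character_def)
  have s': "rep_character \<sigma> (inv g \<otimes> u) = (\<Sum>k<?b. \<Sum>l<?b. \<sigma> (inv g) $$ (k, l) * \<sigma> u $$ (l, k))"
    if "g \<in> carrier G" for g
    using that u s(1)[of "inv g \<otimes> u"]
    by (auto simp: rep_character_def s(3) mat_mult_index[OF s(1) s(1)])
  have "(\<Sum>g\<in>carrier G. rep_character \<rho> g * rep_character \<sigma> (inv g \<otimes> u)) =
     (\<Sum>g\<in>carrier G. \<Sum>i<?a. \<Sum>k<?b. \<Sum>l<?b. \<rho> g $$ (i, i) * \<sigma> (inv g) $$ (k, l) * \<sigma> u $$ (l, k))"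
    by (intro sum.cong refl, subst r', assumption, subst s', assumption, subst sum_distrib_right)
      (simp add: sum_distrib_left mult.assoc)
  also have "\<dots> = (\<Sum>i<?a. \<Sum>k<?b. \<Sum>l<?b. \<Sum>g\<in>carrier G. \<rho> g $$ (i, i) * \<sigma> (inv g) $$ (k, l) * \<sigma> u $$ (l, k))"
    by (subst sum.swap, rule sum.cong[OF refl], subst sum.swap, rule sum.cong[OF refl], subst sum.swap, rule refl)
  finally show ?thesis by (simp add: sum_distrib_right)
qed

lemma character_convolution_noniso:
  fixes \<rho> \<sigma> :: "'g \<Rightarrow> 'a::field_char_0 mat"
  assumes \<sigma>: "irreducible_rep G \<sigma>" and \<rho>: "representation G \<rho>"
    and irr: "irreducible_rep G \<rho> \<or> rep_dim G \<rho> = rep_dim G \<sigma>"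
    and ni: "\<not> rep_iso G \<sigma> \<rho>" and u: "u \<in> carrier G"
  shows "(\<Sum>g\<in>carrier G. rep_character \<rho> g * rep_character \<sigma> (inv g \<otimes> u)) = 0"
  unfolding character_convolution_expand[OF \<rho> irreducible_repD(1)[OF \<sigma>] u]
  by (intro sum.neutral ballI) (simp add: schur_orthogonality[OF \<sigma> \<rho> irr ni])

lemma character_convolution_same:
  fixes V :: "'g \<Rightarrow> complex mat"
  assumes V: "irreducible_rep G V" and u: "u \<in> carrier G"
  shows "(\<Sum>g\<in>carrier G. rep_character V g * rep_character V (inv g \<otimes> u)) =
    of_nat (card (carrier G)) / of_nat (rep_dim G V) * rep_character V u"
proof -
  let ?n = "rep_dim G V" and ?c = "of_nat (card (carrier G)) / of_nat (rep_dim G V) :: complex"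
  note v = irreducible_repD(1)[OF V]
  have "(\<Sum>g\<in>carrier G. rep_character V g * rep_character V (inv g \<otimes> u)) =
    (\<Sum>i<?n. \<Sum>k<?n. \<Sum>l<?n. if l = i then if k = i then ?c * V u $$ (l, k) else 0 else 0)"
    unfolding character_convolution_expand[OF v v u]
    by (intro sum.cong refl) (auto simp: schur_orthogonality_same[OF V])
  also have "\<dots> = (\<Sum>i<?n. ?c * V u $$ (i, i))" by simp
  also have "\<dots> = ?c * rep_character V u"
    using representationD(1)[OF v u] by (auto simp: rep_character_def sum_distrib_left)
  finally show ?thesis .
qed

end

section \<open>Algebraic integers\<close>

text \<open>The characteristic polynomial of an integral matrix is monic with integral
  coefficients.\<close>

lemma integral_eigenvalue_algebraic_int:
  fixes A :: "int mat" and z :: complex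
  assumes A: "A \<in> carrier_mat n n" and z: "eigenvalue (map_mat of_int A) z"
  shows "algebraic_int z"
proof -
  have A': "(map_mat of_int A :: complex mat) \<in> carrier_mat n n" using A by simp
  have hom: "char_poly (map_mat of_int A) = map_poly (of_int :: int \<Rightarrow> complex) (char_poly A)"
    by (rule of_int_hom.char_poly_hom[OF A])
  have "poly (char_poly (map_mat of_int A)) z = 0"
    using iffD1[OF eigenvalue_root_char_poly[OF A'] z] .
  moreover have "lead_coeff (char_poly (map_mat of_int A :: complex mat)) = 1"
    using degree_monic_char_poly[OF A'] by simp
  ultimately show ?thesis
    unfolding hom by (intro algebraic_int.intros) auto
qed

text \<open>The sum is an eigenvalue of the integral matrix of multiplication by it on the powers of a
  primitive root of unity.\<close>

lemma sum_roots_of_unity_algebraic_int: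
  fixes e :: "'i \<Rightarrow> complex"
  assumes I: "finite I" and N: "N > 0" and e: "\<And>i. i \<in> I \<Longrightarrow> e i ^ N = 1"
  shows "algebraic_int (\<Sum>i\<in>I. e i)"
proof -
  define \<zeta> where "\<zeta> = cis (2 * pi / real N)"
  have "\<exists>k. e i = \<zeta> ^ k" if "i \<in> I" for i
  proof -
    have "e i \<in> (\<lambda>k. cis (2 * pi * real k / real N)) ` {..<N}"
      using bij_betw_roots_unity[OF N] e[OF that] by (auto simp: bij_betw_def)
    then show ?thesis unfolding \<zeta>_def by (auto simp: DeMoivre field_simps)
  qed
  then obtain k where k: "\<And>i. i \<in> I \<Longrightarrow> e i = \<zeta> ^ k i" by metis
  have \<zeta>: "\<zeta> ^ N = 1" using N by (simp add: \<zeta>_def DeMoivre)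
  then have \<zeta>_mod: "\<zeta> ^ (m mod N) = \<zeta> ^ m" for m
    by (metis mult_div_mod_eq power_add power_mult power_one mult_1)
  \<comment> \<open>Row a writes \<open>\<zeta> ^ a\<close> times the sum as a combination of powers
    of \<open>\<zeta>\<close> with exponents reduced mod N; the entries are multiplicities. These
    powers are linearly dependent in general, which does no harm to an eigenvector.\<close>
  define A :: "int mat" where "A = mat N N (\<lambda>(a, b). \<Sum>i\<in>I. if (a + k i) mod N = b then 1 else 0)"
  define v where "v = vec N (\<lambda>b. \<zeta> ^ b)"
  have "map_mat of_int A *\<^sub>v v = (\<Sum>i\<in>I. e i) \<cdot>\<^sub>v v"
  proof (rule eq_vecI)
    fix a assume "a < dim_vec ((\<Sum>i\<in>I. e i) \<cdot>\<^sub>v v)"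
    then have a: "a < N" by (simp add: v_def)
    have "(map_mat of_int A *\<^sub>v v) $ a =
        (\<Sum>b<N. \<Sum>i\<in>I. if (a + k i) mod N = b then \<zeta> ^ b else 0)"
      using a by (auto simp: A_def v_def scalar_prod_def atLeast0LessThan sum_distrib_right intro!: sum.cong)
    also have "\<dots> = (\<Sum>i\<in>I. \<Sum>b<N. if (a + k i) mod N = b then \<zeta> ^ b else 0)"
      by (rule sum.swap)
    also have "\<dots> = (\<Sum>i\<in>I. \<zeta> ^ (a + k i))"
      using N by (intro sum.cong) (auto simp: \<zeta>_mod)
    also have "\<dots> = ((\<Sum>i\<in>I. e i) \<cdot>\<^sub>v v) $ a"
      using a by (simp add: v_def k power_add sum_distrib_left mult.commute)
    finally show "(map_mat of_int A *\<^sub>v v) $ a = ((\<Sum>i\<in>I. e i) \<cdot>\<^sub>v v) $ a" .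
  qed (simp add: A_def v_def)
  moreover have "v \<noteq> 0\<^sub>v N"
  proof
    assume "v = 0\<^sub>v N"
    then have "v $ 0 = 0" using N by simp
    then show False using N by (simp add: v_def)
  qed
  ultimately have "eigenvector (map_mat of_int A) v (\<Sum>i\<in>I. e i)"
    by (simp add: eigenvector_def A_def v_def)
  then have "eigenvalue (map_mat of_int A) (\<Sum>i\<in>I. e i)"
    unfolding eigenvalue_def by blast
  then show ?thesis by (intro integral_eigenvalue_algebraic_int[of A N]) (auto simp: A_def)
qed

text \<open>All powers of q have the common denominator N. With q = a/t in lowest terms, every power
  of t then divides N, so t = 1.\<close>

lemma rat_int_of_powers:
  fixes q :: rat
  assumes N: "N \<noteq> (0::int)" and int: "\<And>m. q ^ m * of_int N \<in> \<int>"
  shows "q \<in> \<int>"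
proof -
  obtain a t where q: "quotient_of q = (a, t)" by fastforce
  have t: "t > 0" and cop: "coprime a t" and qe: "q = of_int a / of_int t"
    using q quotient_of_denom_pos quotient_of_coprime quotient_of_div by auto
  have "t ^ m dvd N" for m
  proof -
    obtain w where "q ^ m * of_int N = of_int w" using int[of m] by (auto elim: Ints_cases)
    then have "of_int (a ^ m * N) = (of_int (t ^ m * w) :: rat)"
      using t by (simp add: qe power_divide field_simps)
    then have "a ^ m * N = t ^ m * w" by (simp only: of_int_eq_iff)
    then have "t ^ m dvd a ^ m * N" by simp
    then show ?thesis using cop by (simp add: coprime_dvd_mult_right_iff coprime_commute)
  qed
  then have le: "t ^ m \<le> \<bar>N\<bar>" for m using dvd_imp_le_int[OF N] t by fastforce
  have "t = 1"
  proof (rule ccontr)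
    assume "t \<noteq> 1"
    then have "(2::int) ^ nat \<bar>N\<bar> \<le> t ^ nat \<bar>N\<bar>" using t by (intro power_mono) auto
    moreover have "int (nat \<bar>N\<bar>) < 2 ^ nat \<bar>N\<bar>" by (metis less_exp of_nat_less_numeral_power_cancel_iff)
    ultimately show False using le[of "nat \<bar>N\<bar>"] by linarith
  qed
  then show ?thesis by (simp add: qe)
qed

context finite_group
begin

lemma rep_pow:
  fixes \<rho> :: "'g \<Rightarrow> 'a::field mat"
  assumes \<rho>: "representation G \<rho>" and g: "g \<in> carrier G"
  shows "\<rho> (g [^] (m::nat)) = \<rho> g ^\<^sub>m m"
  using representationD(2,3)[OF \<rho>] g representationD(1)[OF \<rho> g]
  by (induction m) (auto simp: nat_pow_Suc)

text \<open>An upper triangular form of V g has the eigenvalues on its diagonal, and they are roots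
  of unity because the |G|-th power of V g is the identity.\<close>

lemma character_sum_roots_of_unity:
  fixes V :: "'g \<Rightarrow> complex mat"
  assumes V: "representation G V" and g: "g \<in> carrier G"
  shows "\<exists>e. (\<forall>i<rep_dim G V. e i ^ card (carrier G) = 1) \<and> rep_character V g = (\<Sum>i<rep_dim G V. e i)"
proof -
  let ?n = "rep_dim G V" and ?N = "card (carrier G)"
  have A: "V g \<in> carrier_mat ?n ?n" by (rule representationD(1)[OF V g])
  obtain as where as: "char_poly (V g) = (\<Prod>a\<leftarrow>as. [:- a, 1:])" using char_poly_factorized[OF A] by blast
  obtain B where B: "B \<in> carrier_mat ?n ?n" "upper_triangular B" "similar_mat (V g) B"
    using schur_decomposition_exists[OF A as] by blast
  obtain P Q where PQ: "similar_mat_wit (V g) B P Q" using B(3) unfolding similar_mat_def by blast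
  note w = similar_mat_witD2[OF A PQ]
  have "mat_trace (V g) = mat_trace (P * (B * Q))" using w by (simp add: assoc_mult_mat[of _ ?n ?n _ ?n])
  also have "\<dots> = mat_trace (B * Q * P)" using w by (intro mat_trace_comm) auto
  also have "B * Q * P = B" using w by (simp add: assoc_mult_mat[of _ ?n ?n _ ?n])
  finally have tr: "rep_character V g = (\<Sum>i<?n. B $$ (i, i))"
    using B(1) unfolding rep_character_eq_trace by (auto simp: mat_trace_def)
  have pow: "V g ^\<^sub>m ?N = 1\<^sub>m ?n"
    using rep_pow[OF V g, of ?N] pow_order_eq_1[OF g] representationD(2)[OF V]
    by (simp add: Coset.order_def)
  have "B $$ (i, i) ^ ?N = 1" if i: "i < ?n" for i
  proof -
    have "B $$ (i, i) \<in> set (diag_mat B)" using B(1) i by (auto simp: diag_mat_def)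
    then have "poly (char_poly B) (B $$ (i, i)) = 0"
      unfolding char_poly_upper_triangular[OF B(1,2)] by (auto simp: poly_prod_list prod_list_zero_iff)
    then have "eigenvalue (V g) (B $$ (i, i))"
      using char_poly_similar[OF B(3)] eigenvalue_root_char_poly[OF A] by simp
    then obtain v where v: "eigenvector (V g) v (B $$ (i, i))" unfolding eigenvalue_def by blast
    have "V g ^\<^sub>m ?N *\<^sub>v v = B $$ (i, i) ^ ?N \<cdot>\<^sub>v v" by (rule eigenvector_pow[OF A v])
    moreover have vc: "v \<in> carrier_vec ?n" "v \<noteq> 0\<^sub>v ?n" using v A unfolding eigenvector_def by auto
    ultimately have eq: "v = B $$ (i, i) ^ ?N \<cdot>\<^sub>v v" using pow by simp
    have "\<exists>j<?n. v $ j \<noteq> 0"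
    proof (rule ccontr)
      assume "\<not> ?thesis"
      then have "v = 0\<^sub>v ?n" using vc(1) by (intro eq_vecI) auto
      with vc(2) show False by simp
    qed
    then obtain j where j: "j < ?n" "v $ j \<noteq> 0" by blast
    have "v $ j = B $$ (i, i) ^ ?N * v $ j" using arg_cong[OF eq, of "\<lambda>v. v $ j"] vc(1) j(1) by auto
    then show ?thesis using j(2) by simp
  qed
  then show ?thesis using tr by (intro exI[of _ "\<lambda>i. B $$ (i, i)"]) simp
qed

end

section \<open>Galois conjugates of characters\<close>

lemma sum_lessThan_if_add:
  fixes f h :: "nat \<Rightarrow> 'a::comm_monoid_add"
  shows "(\<Sum>i<a + b. if i < a then f i else h (i - a)) = (\<Sum>i<a. f i) + (\<Sum>i<b. h i)"
  by (induction b) (simp_all add: add.assoc)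

lemma mat_trace_diag_block:
  assumes "\<And>A. A \<in> set As \<Longrightarrow> square_mat A"
  shows "mat_trace (diag_block_mat As) = (\<Sum>A\<leftarrow>As. mat_trace A)"
  using assms
proof (induction As)
  case Nil
  then show ?case by (simp add: mat_trace_def)
next
  case (Cons A As)
  let ?B = "diag_block_mat As"
  have A: "dim_col A = dim_row A" and B: "dim_col ?B = dim_row ?B"
    using Cons.prems diag_block_mat_square[of As] by auto
  have "mat_trace (diag_block_mat (A # As)) =
      (\<Sum>i<dim_row A + dim_row ?B. if i < dim_row A then A $$ (i, i) else ?B $$ (i - dim_row A, i - dim_row A))"
    using A B by (auto simp: mat_trace_def Let_def intro!: sum.cong)
  also have "\<dots> = mat_trace A + mat_trace ?B"
    unfolding mat_trace_def by (rule sum_lessThan_if_add)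
  finally show ?case using Cons by simp
qed

text \<open>Such maps need not be continuous: a conjugate representation is formed by extending
  \<tau> from the character field to all matrix entries, and the extension is an abstract field
  automorphism.\<close>

definition complex_automorphism :: "(complex \<Rightarrow> complex) \<Rightarrow> bool" where
  "complex_automorphism s \<longleftrightarrow> s \<in> ring_iso class_ring class_ring"

lemma complex_automorphismD:
  assumes "complex_automorphism s"
  shows "bij s" "s (x + y) = s x + s y" "s (x * y) = s x * s y" "s 1 = 1" "s 0 = 0"
proof -
  have *: "bij_betw s UNIV UNIV" "\<And>x y. s (x + y) = s x + s y" "\<And>x y. s (x * y) = s x * s y" "s 1 = 1"
    using assms unfolding complex_automorphism_def ring_iso_def Ring.ring_hom_def by auto
  then show "bij s" "s (x + y) = s x + s y" "s (x * y) = s x * s y" "s 1 = 1" by auto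
  show "s 0 = 0" using *(2)[of 0 0] by simp
qed

lemma complex_automorphism_semiring_hom: "complex_automorphism s \<Longrightarrow> semiring_hom s"
  using complex_automorphismD by unfold_locales auto

lemma complex_automorphism_sum:
  assumes "complex_automorphism s"
  shows "s (\<Sum>i\<in>I. f i) = (\<Sum>i\<in>I. s (f i))"
  by (induction I rule: infinite_finite_induct) (simp_all add: complex_automorphismD[OF assms])

lemma complex_automorphism_power: "complex_automorphism s \<Longrightarrow> s (x ^ m) = s x ^ m"
  by (induction m) (simp_all add: complex_automorphismD)

lemma complex_automorphism_of_nat: "complex_automorphism s \<Longrightarrow> s (of_nat m) = of_nat m"
  by (induction m) (simp_all add: complex_automorphismD)

lemma complex_automorphism_uminus: "complex_automorphism s \<Longrightarrow> s (- x) = - s x"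
  using complex_automorphismD(2)[of s x "- x"] complex_automorphismD(5)[of s] by (simp add: eq_neg_iff_add_eq_0 add.commute)

lemma complex_automorphism_inverse:
  assumes s: "complex_automorphism s"
  shows "s (inverse x) = inverse (s x)"
proof (cases "x = 0")
  case False
  then have "s x * s (inverse x) = 1" using complex_automorphismD(3,4)[OF s] by (metis right_inverse)
  then show ?thesis by (metis inverse_unique)
qed (simp add: complex_automorphismD[OF s])

lemma complex_automorphism_inv:
  assumes s: "complex_automorphism s"
  shows "complex_automorphism (Hilbert_Choice.inv s)"
  using ring_iso_set_sym[of class_ring s class_ring] class_ring.ring_axioms s
  unfolding complex_automorphism_def by simp

lemma complex_automorphism_comp:
  assumes "complex_automorphism s" "complex_automorphism t"
  shows "complex_automorphism (s \<circ> t)"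
  using ring_iso_set_trans[of t class_ring class_ring s] assms
  unfolding complex_automorphism_def by simp

lemma class_ring_m_inv:
  fixes x :: "'a::field"
  assumes "x \<noteq> 0"
  shows "inv\<^bsub>class_ring\<^esub> x = inverse x"
  unfolding m_inv_def using assms by (intro the_equality) (auto simp: field_simps)

text \<open>Field operations preserve agreement. For the character field this says that two
  automorphisms that differ on the field already differ at some character value.\<close>

lemma automorphisms_eq_on_generate_field:
  assumes s: "complex_automorphism s" and t: "complex_automorphism t"
    and eq: "\<And>x. x \<in> A \<Longrightarrow> s x = t x"
    and x: "x \<in> generate_field class_ring A"
  shows "s x = t x"
  using x
proof (induction rule: generate_field.induct)
  case (a_inv h)
  then show ?case using complex_automorphism_uminus[OF s] complex_automorphism_uminus[OF t]
    by (simp add: class_ring_simps)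
next
  case (m_inv h)
  then show ?case using complex_automorphism_inverse[OF s] complex_automorphism_inverse[OF t]
    by (simp add: class_ring_m_inv)
qed (use complex_automorphismD[OF s] complex_automorphismD[OF t] eq in auto)

lemma representation_conjugate:
  assumes s: "complex_automorphism s" and V: "representation G V"
  shows "representation G (\<lambda>g. map_mat s (V g))" "rep_dim G (\<lambda>g. map_mat s (V g)) = rep_dim G V"
proof -
  interpret semiring_hom s by (rule complex_automorphism_semiring_hom[OF s])
  show dim: "rep_dim G (\<lambda>g. map_mat s (V g)) = rep_dim G V" by (simp add: rep_dim_def)
  show "representation G (\<lambda>g. map_mat s (V g))"
    unfolding representation_def dim
    using representationD[OF V] by (auto simp: mat_hom_one mat_hom_mult[OF representationD(1)[OF V] representationD(1)[OF V]])
qed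

lemma rep_character_conjugate:
  assumes s: "complex_automorphism s" and V: "representation G V" and g: "g \<in> carrier G"
  shows "rep_character (\<lambda>g. map_mat s (V g)) g = s (rep_character V g)"
  using representationD(1)[OF V g]
  by (auto simp: rep_character_def complex_automorphism_sum[OF s])

text \<open>For an associated pair W, V this is the sum of the characters of the Galois conjugates
  of V, that is, the character of W divided by the Schur index.\<close>

definition galois_character :: "'g monoid \<Rightarrow> ('g \<Rightarrow> complex mat) \<Rightarrow> 'g \<Rightarrow> complex" where
  "galois_character G V g = galois_trace (character_field G V) (rep_character V g)"

lemma rep_character_in_character_field:
  "g \<in> carrier G \<Longrightarrow> rep_character V g \<in> character_field G V"
  unfolding character_field_def by (intro generate_field.incl) blast

lemma rep_character_class:
  fixes \<rho> :: "'g \<Rightarrow> 'a::field mat"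
  assumes \<rho>: "representation G \<rho>" and "x \<in> carrier G" "y \<in> carrier G"
  shows "rep_character \<rho> (x \<otimes>\<^bsub>G\<^esub> y) = rep_character \<rho> (y \<otimes>\<^bsub>G\<^esub> x)"
  using assms mat_trace_comm[OF representationD(1)[OF \<rho>] representationD(1)[OF \<rho>], of x y]
  by (simp add: rep_character_eq_trace representationD(3)[OF \<rho>])

lemma sum_list_concat_replicate:
  fixes f :: "'a \<Rightarrow> 'b::semiring_1"
  shows "(\<Sum>x\<leftarrow>concat (replicate m xs). f x) = of_nat m * (\<Sum>x\<leftarrow>xs. f x)"
  by (induction m) (simp_all add: algebra_simps)

text \<open>Traces are taken in the block diagonal form of W. The list of conjugates in
  \<open>associated_complex_rep\<close> also shows that the Galois group is finite, and the
  witnesses of \<open>is_galois_conjugate\<close> extend its elements to automorphisms of the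
  complex numbers.\<close>

lemma associated_complex_rep_galois:
  assumes "group G" and W: "irreducible_rep G W" and assoc: "associated_complex_rep G W V"
  defines "\<Gamma> \<equiv> galois_group (character_field G V)"
  shows "finite \<Gamma> \<and> \<Gamma> \<noteq> {} \<and>
    (\<exists>s. \<forall>\<tau>\<in>\<Gamma>. complex_automorphism (s \<tau>) \<and> (\<forall>x\<in>character_field G V. s \<tau> x = \<tau> x)) \<and>
    (\<exists>m>0::nat. \<forall>g\<in>carrier G. of_rat (rep_character W g) = of_nat m * galois_character G V g)"
proof -
  interpret group G by fact
  let ?L = "character_field G V" and ?m = "schur_index G V"
  obtain \<tau>s C where \<tau>s: "distinct \<tau>s" "set \<tau>s = \<Gamma>"
    and C: "\<And>\<tau>. \<tau> \<in> \<Gamma> \<Longrightarrow> is_galois_conjugate ?L \<tau> V (C \<tau>)"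
    and iso: "rep_iso G (complexification W)
          (\<lambda>g. diag_block_mat (concat (replicate ?m (map (\<lambda>\<tau>. C \<tau> g) \<tau>s))))"
    using assoc unfolding associated_complex_rep_def \<Gamma>_def by metis
  have V: "representation G V" using assoc unfolding associated_complex_rep_def irreducible_rep_def by blast
  have "\<forall>\<tau>\<in>\<Gamma>. \<exists>s. complex_automorphism s \<and> (\<forall>x\<in>?L. s x = \<tau> x) \<and> C \<tau> = (\<lambda>g. map_mat s (V g))"
    using C unfolding is_galois_conjugate_def complex_automorphism_def by blast
  from bchoice[OF this] obtain s where *: "\<forall>\<tau>\<in>\<Gamma>. complex_automorphism (s \<tau>) \<and>
      (\<forall>x\<in>?L. s \<tau> x = \<tau> x) \<and> C \<tau> = (\<lambda>g. map_mat (s \<tau>) (V g))" by (elim exE)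
  have s: "complex_automorphism (s \<tau>)" if "\<tau> \<in> \<Gamma>" for \<tau> using * that by blast
  have ext: "s \<tau> x = \<tau> x" if "\<tau> \<in> \<Gamma>" "x \<in> ?L" for \<tau> x using * that by blast
  have Cs: "C \<tau> = (\<lambda>g. map_mat (s \<tau>) (V g))" if "\<tau> \<in> \<Gamma>" for \<tau> using * that by blast
  define D where "D = (\<lambda>g. diag_block_mat (concat (replicate ?m (map (\<lambda>\<tau>. C \<tau> g) \<tau>s))))"
  note Vc = representationD(1)[OF V]
  have sq: "square_mat A"
    if A: "A \<in> set (concat (replicate ?m (map (\<lambda>\<tau>. C \<tau> g) \<tau>s)))" and g: "g \<in> carrier G" for A g
  proof -
    obtain \<tau> where "\<tau> \<in> \<Gamma>" "A = C \<tau> g" using A \<tau>s(2) by (auto split: if_splits)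
    then show ?thesis using Vc[OF g] by (simp add: Cs)
  qed
  \<comment> \<open>The size does not depend on g, since every block is as large as V.\<close>
  have dimD: "dim_row (D g) = rep_dim G D" if "g \<in> carrier G" for g
  proof -
    have "dim_row (D g) = sum_list (map dim_row (concat (replicate ?m (map (\<lambda>\<tau>. C \<tau> g) \<tau>s))))" for g
      unfolding D_def dim_diag_block_mat ..
    moreover have "map dim_row (concat (replicate ?m (map (\<lambda>\<tau>. C \<tau> g) \<tau>s))) =
        concat (replicate ?m (map (\<lambda>\<tau>. rep_dim G V) \<tau>s))" if "g \<in> carrier G" for g
      using Cs \<tau>s(2) Vc[OF that] by (auto simp: map_concat intro!: arg_cong[of _ _ concat] arg_cong[of _ _ "replicate ?m"])
    ultimately show ?thesis using that unfolding rep_dim_def[of G D] by simp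
  qed
  have Dc: "D g \<in> carrier_mat (rep_dim G D) (rep_dim G D)" if "g \<in> carrier G" for g
  proof -
    have "square_mat (D g)"
      unfolding D_def using sq[OF _ that] by (intro diag_block_mat_square ballI)
    then show ?thesis using dimD[OF that] by (intro carrier_matI) auto
  qed
  have trD: "mat_trace (D g) = of_nat ?m * galois_character G V g" if g: "g \<in> carrier G" for g
  proof -
    have "mat_trace (D g) = (\<Sum>A\<leftarrow>concat (replicate ?m (map (\<lambda>\<tau>. C \<tau> g) \<tau>s)). mat_trace A)"
      unfolding D_def using sq[OF _ g] by (intro mat_trace_diag_block)
    also have "\<dots> = of_nat ?m * (\<Sum>\<tau>\<leftarrow>\<tau>s. mat_trace (C \<tau> g))"
      by (simp add: sum_list_concat_replicate comp_def)
    also have "(\<Sum>\<tau>\<leftarrow>\<tau>s. mat_trace (C \<tau> g)) = (\<Sum>\<tau>\<in>\<Gamma>. mat_trace (C \<tau> g))"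
      using \<tau>s by (simp add: sum_list_distinct_conv_sum_set)
    also have "\<dots> = (\<Sum>\<tau>\<in>\<Gamma>. \<tau> (rep_character V g))"
    proof (intro sum.cong refl)
      fix \<tau> assume \<tau>: "\<tau> \<in> \<Gamma>"
      show "mat_trace (C \<tau> g) = \<tau> (rep_character V g)"
        using rep_character_conjugate[OF s[OF \<tau>] V g] ext[OF \<tau> rep_character_in_character_field[OF g]]
        by (simp add: Cs[OF \<tau>] rep_character_eq_trace)
    qed
    finally show ?thesis by (simp add: galois_character_def galois_trace_def \<Gamma>_def)
  qed
  have Wc: "complexification W g \<in> carrier_mat (rep_dim G (complexification W)) (rep_dim G (complexification W))"
    if "g \<in> carrier G" for g
    using representationD(1)[OF irreducible_repD(1)[OF W] that] by (simp add: complexification_def rep_dim_def)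
  have iso: "rep_iso G (complexification W) D" using iso unfolding D_def .
  have ch: "of_rat (rep_character W g) = of_nat ?m * galois_character G V g" if g: "g \<in> carrier G" for g
  proof -
    have "of_rat (rep_character W g) = rep_character (complexification W) g"
      using representationD(1)[OF irreducible_repD(1)[OF W] g]
      by (auto simp: rep_character_def complexification_def of_rat_sum)
    also have "\<dots> = rep_character D g" using Wc[OF g] Dc[OF g] by (intro rep_iso_character[OF iso g])
    finally show ?thesis by (simp add: rep_character_eq_trace trD[OF g])
  qed
  \<comment> \<open>If the Schur index were 0 or the Galois group empty, the block matrix would have
    size 0, contrary to the positive dimension of W.\<close>
  have pos: "rep_dim G D > 0" using iso irreducible_repD(2)[OF W]
    by (simp add: rep_iso_def rep_dim_def complexification_def)
  have m: "?m > 0" using pos by (cases ?m) (auto simp: D_def rep_dim_def)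
  have "\<Gamma> \<noteq> {}"
  proof
    assume "\<Gamma> = {}"
    then have "D g = diag_block_mat []" for g using \<tau>s(2) unfolding D_def by (simp add: concat_replicate_trivial)
    then show False using pos by (simp add: rep_dim_def)
  qed
  moreover have "finite \<Gamma>" using \<tau>s(2) by (metis List.finite_set)
  ultimately show ?thesis using s ext m ch by blast
qed

context finite_group
begin

text \<open>The value is rational as a character value of W divided by m, and an algebraic integer
  as a sum of images of roots of unity. The eigenvalues \<open>e i\<close> may lie outside the
  character field, hence the use of the extensions \<open>s \<tau>\<close>.\<close>

lemma galois_character_Ints:
  fixes V :: "'g \<Rightarrow> complex mat"
  assumes W: "irreducible_rep G W" and assoc: "associated_complex_rep G W V" and g: "g \<in> carrier G"
  shows "galois_character G V g \<in> \<int>"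
proof -
  let ?\<Gamma> = "galois_group (character_field G V)" and ?n = "rep_dim G V"
  have V: "representation G V" using assoc unfolding associated_complex_rep_def irreducible_rep_def by blast
  note gal_facts = associated_complex_rep_galois[OF group_axioms W assoc]
  have fin_\<Gamma>: "finite ?\<Gamma>" using gal_facts by blast
  from gal_facts obtain s where *: "\<forall>\<tau>\<in>?\<Gamma>. complex_automorphism (s \<tau>) \<and>
      (\<forall>x\<in>character_field G V. s \<tau> x = \<tau> x)" by (elim conjE exE)
  have s: "complex_automorphism (s \<tau>)" if "\<tau> \<in> ?\<Gamma>" for \<tau> using * that by blast
  have ext: "s \<tau> x = \<tau> x" if "\<tau> \<in> ?\<Gamma>" "x \<in> character_field G V" for \<tau> x using * that by blast
  from gal_facts obtain m where m: "m > (0::nat)"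
    and W': "\<And>g. g \<in> carrier G \<Longrightarrow> of_rat (rep_character W g) = of_nat m * galois_character G V g"
    by blast
  from character_sum_roots_of_unity[OF V g]
  obtain e where e: "\<forall>i<?n. e i ^ card (carrier G) = 1" and \<chi>: "rep_character V g = (\<Sum>i<?n. e i)"
    by (elim exE conjE)
  have "galois_character G V g = (\<Sum>\<tau>\<in>?\<Gamma>. s \<tau> (rep_character V g))"
    unfolding galois_character_def galois_trace_def
    using ext rep_character_in_character_field[OF g] by (intro sum.cong) auto
  also have "\<dots> = (\<Sum>\<tau>\<in>?\<Gamma>. \<Sum>i<?n. s \<tau> (e i))"
    using complex_automorphism_sum[OF s] \<chi> by (intro sum.cong) auto
  also have "\<dots> = (\<Sum>(\<tau>, i)\<in>?\<Gamma> \<times> {..<?n}. s \<tau> (e i))" by (rule sum.cartesian_product)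
  finally have sum: "galois_character G V g = (\<Sum>(\<tau>, i)\<in>?\<Gamma> \<times> {..<?n}. s \<tau> (e i))" .
  have "algebraic_int (galois_character G V g)"
    unfolding sum
  proof (rule sum_roots_of_unity_algebraic_int)
    show "finite (?\<Gamma> \<times> {..<?n})" using fin_\<Gamma> by simp
    show "card (carrier G) > 0" using fin one_closed by (metis card_gt_0_iff empty_iff)
    fix x assume "x \<in> ?\<Gamma> \<times> {..<?n}"
    then obtain \<tau> i where x: "x = (\<tau>, i)" "\<tau> \<in> ?\<Gamma>" "i < ?n" by auto
    show "(case x of (\<tau>, i) \<Rightarrow> s \<tau> (e i)) ^ card (carrier G) = 1"
      using complex_automorphism_power[OF s[OF x(2)], of "e i" "card (carrier G)"] e x(3)
        complex_automorphismD(4)[OF s[OF x(2)]] x(1) by simp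
  qed
  moreover have "galois_character G V g = of_rat (rep_character W g / of_nat m)"
    using W'[OF g] m by (simp add: of_rat_divide field_simps)
  then have "galois_character G V g \<in> \<rat>" by simp
  ultimately show ?thesis by (rule rational_algebraic_int_is_int)
qed

lemma galois_character_class:
  fixes V :: "'g \<Rightarrow> complex mat"
  assumes "representation G V" "x \<in> carrier G" "y \<in> carrier G"
  shows "galois_character G V (x \<otimes> y) = galois_character G V (y \<otimes> x)"
  using rep_character_class[OF assms] by (simp add: galois_character_def)

text \<open>Distinct conjugates \<open>V\<^sup>\<tau>\<close> and \<open>V\<^sup>\<sigma>\<close> are not isomorphic, because \<open>\<tau>\<close> and \<open>\<sigma>\<close> differ on some
  character value; applying \<open>\<sigma>\<inverse>\<close> reduces orthogonality to the irreducibility of \<open>V\<close> alone.\<close>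

lemma galois_character_convolution_same:
  fixes V :: "'g \<Rightarrow> complex mat"
  assumes W: "irreducible_rep G W" and assoc: "associated_complex_rep G W V" and u: "u \<in> carrier G"
  shows "(\<Sum>g\<in>carrier G. galois_character G V g * galois_character G V (inv g \<otimes> u)) =
    of_nat (card (carrier G)) / of_nat (rep_dim G V) * galois_character G V u"
proof -
  let ?\<Gamma> = "galois_group (character_field G V)" and ?\<chi> = "rep_character V"
  let ?c = "of_nat (card (carrier G)) / of_nat (rep_dim G V) :: complex"
  have irr: "irreducible_rep G V" using assoc unfolding associated_complex_rep_def by blast
  note V = irreducible_repD(1)[OF irr]
  note gal_facts = associated_complex_rep_galois[OF group_axioms W assoc]
  have fin_\<Gamma>: "finite ?\<Gamma>" using gal_facts by blast
  from gal_facts obtain s where *: "\<forall>\<tau>\<in>?\<Gamma>. complex_automorphism (s \<tau>) \<and>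
      (\<forall>x\<in>character_field G V. s \<tau> x = \<tau> x)" by (elim conjE exE)
  have s: "complex_automorphism (s \<tau>)" if "\<tau> \<in> ?\<Gamma>" for \<tau> using * that by blast
  have ext: "s \<tau> x = \<tau> x" if "\<tau> \<in> ?\<Gamma>" "x \<in> character_field G V" for \<tau> x using * that by blast
  have gal: "galois_character G V g = (\<Sum>\<tau>\<in>?\<Gamma>. s \<tau> (?\<chi> g))" if "g \<in> carrier G" for g
    unfolding galois_character_def galois_trace_def
    using ext rep_character_in_character_field[OF that] by (intro sum.cong) auto
  have conv: "(\<Sum>g\<in>carrier G. s \<tau> (?\<chi> g) * s \<sigma> (?\<chi> (inv g \<otimes> u))) = (if \<tau> = \<sigma> then ?c * s \<sigma> (?\<chi> u) else 0)"
    if \<tau>: "\<tau> \<in> ?\<Gamma>" and \<sigma>: "\<sigma> \<in> ?\<Gamma>" for \<tau> \<sigma>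
  proof -
    define t where "t = Hilbert_Choice.inv (s \<sigma>) \<circ> s \<tau>"
    have t: "complex_automorphism t"
      unfolding t_def by (intro complex_automorphism_comp complex_automorphism_inv s \<sigma> \<tau>)
    have st: "s \<tau> x = s \<sigma> (t x)" for x
      using complex_automorphismD(1)[OF s[OF \<sigma>]] by (simp add: t_def bij_is_surj surj_f_inv_f)
    define V' where "V' = (\<lambda>g. map_mat t (V g))"
    have V': "representation G V'" "rep_dim G V' = rep_dim G V"
      unfolding V'_def using representation_conjugate[OF t V] by auto
    have \<chi>': "rep_character V' g = t (?\<chi> g)" if "g \<in> carrier G" for g
      unfolding V'_def by (rule rep_character_conjugate[OF t V that])
    have "(\<Sum>g\<in>carrier G. s \<tau> (?\<chi> g) * s \<sigma> (?\<chi> (inv g \<otimes> u))) =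
        s \<sigma> (\<Sum>g\<in>carrier G. rep_character V' g * ?\<chi> (inv g \<otimes> u))"
      using st \<chi>' by (simp add: complex_automorphism_sum[OF s[OF \<sigma>]] complex_automorphismD(3)[OF s[OF \<sigma>]])
    also have "(\<Sum>g\<in>carrier G. rep_character V' g * ?\<chi> (inv g \<otimes> u)) = (if \<tau> = \<sigma> then ?c * ?\<chi> u else 0)"
    proof (cases "\<tau> = \<sigma>")
      case True
      have "t x = x" for x
        using complex_automorphismD(1)[OF s[OF \<sigma>]] True by (simp add: t_def bij_is_inj inv_f_f)
      then show ?thesis using character_convolution_same[OF irr u] True \<chi>' by simp
    next
      case False
      have "\<not> rep_iso G V V'"
      proof
        assume iso: "rep_iso G V V'"
        have "?\<chi> g = t (?\<chi> g)" if "g \<in> carrier G" for g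
          unfolding \<chi>'[OF that, symmetric]
          by (rule rep_iso_character[OF iso that representationD(1)[OF V that] representationD(1)[OF V'(1) that]])
        then have "s \<tau> x = s \<sigma> x" if "x \<in> rep_character V ` carrier G" for x
          using that unfolding st by (metis imageE)
        then have "s \<tau> x = s \<sigma> x" if "x \<in> character_field G V" for x
          using automorphisms_eq_on_generate_field[OF s[OF \<tau>] s[OF \<sigma>]] that
          unfolding character_field_def by blast
        then have "\<tau> x = \<sigma> x" if "x \<in> character_field G V" for x
          using ext[OF \<tau> that] ext[OF \<sigma> that] that by simp
        \<comment> \<open>Agreement on the character field is agreement everywhere, since elements
          of the Galois group are \<open>undefined\<close> outside it.\<close>
        moreover have "\<tau> \<in> extensional (character_field G V)" "\<sigma> \<in> extensional (character_field G V)"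
          using \<tau> \<sigma> unfolding galois_group_def by auto
        ultimately have "\<tau> = \<sigma>" by (intro extensionalityI)
        then show False using False by simp
      qed
      \<comment> \<open>V' enters through the alternative of equal dimension.\<close>
      then show ?thesis using character_convolution_noniso[OF irr V'(1) _ _ u] V'(2) False by simp
    qed
    also have "s \<sigma> (if \<tau> = \<sigma> then ?c * ?\<chi> u else 0) = (if \<tau> = \<sigma> then ?c * s \<sigma> (?\<chi> u) else 0)"
      using complex_automorphismD[OF s[OF \<sigma>]] complex_automorphism_of_nat[OF s[OF \<sigma>]]
        complex_automorphism_inverse[OF s[OF \<sigma>]]
      by (simp add: divide_inverse)
    finally show ?thesis .
  qed
  have "(\<Sum>g\<in>carrier G. galois_character G V g * galois_character G V (inv g \<otimes> u)) =
      (\<Sum>g\<in>carrier G. \<Sum>\<tau>\<in>?\<Gamma>. \<Sum>\<sigma>\<in>?\<Gamma>. s \<tau> (?\<chi> g) * s \<sigma> (?\<chi> (inv g \<otimes> u)))"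
    using u by (intro sum.cong refl) (simp add: gal sum_product)
  also have "\<dots> = (\<Sum>\<tau>\<in>?\<Gamma>. \<Sum>\<sigma>\<in>?\<Gamma>. \<Sum>g\<in>carrier G. s \<tau> (?\<chi> g) * s \<sigma> (?\<chi> (inv g \<otimes> u)))"
    by (subst sum.swap, rule sum.cong[OF refl], rule sum.swap)
  also have "\<dots> = (\<Sum>\<tau>\<in>?\<Gamma>. \<Sum>\<sigma>\<in>?\<Gamma>. if \<tau> = \<sigma> then ?c * s \<sigma> (?\<chi> u) else 0)"
    using conv by (intro sum.cong refl)
  also have "\<dots> = ?c * galois_character G V u"
    using fin_\<Gamma> by (simp add: gal[OF u] sum_distrib_left)
  finally show ?thesis .
qed

text \<open>The characters of W and W' are orthogonal over the rationals and are positive multiples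
  of the two Galois sums, so no complex constituents have to be compared.\<close>

lemma galois_character_convolution_distinct:
  fixes V V' :: "'g \<Rightarrow> complex mat"
  assumes W: "irreducible_rep G W" and assoc: "associated_complex_rep G W V"
    and W': "irreducible_rep G W'" and assoc': "associated_complex_rep G W' V'"
    and ni: "\<not> rep_iso G W' W" and u: "u \<in> carrier G"
  shows "(\<Sum>g\<in>carrier G. galois_character G V g * galois_character G V' (inv g \<otimes> u)) = 0"
proof -
  obtain m where m: "m > (0::nat)"
    "\<And>g. g \<in> carrier G \<Longrightarrow> of_rat (rep_character W g) = of_nat m * galois_character G V g"
    using associated_complex_rep_galois[OF group_axioms W assoc] by blast
  obtain m' where m': "m' > (0::nat)"
    "\<And>g. g \<in> carrier G \<Longrightarrow> of_rat (rep_character W' g) = of_nat m' * galois_character G V' g"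
    using associated_complex_rep_galois[OF group_axioms W' assoc'] by blast
  have "(\<Sum>g\<in>carrier G. of_nat m * galois_character G V g * (of_nat m' * galois_character G V' (inv g \<otimes> u))) =
     (\<Sum>g\<in>carrier G. of_rat (rep_character W g) * of_rat (rep_character W' (inv g \<otimes> u)))"
    using u m(2) m'(2) by (intro sum.cong) auto
  also have "\<dots> = of_rat (\<Sum>g\<in>carrier G. rep_character W g * rep_character W' (inv g \<otimes> u))"
    by (simp add: of_rat_sum of_rat_mult)
  also have "\<dots> = 0"
    using character_convolution_noniso[OF W' irreducible_repD(1)[OF W] _ ni u] W by simp
  finally have "of_nat (m * m') * (\<Sum>g\<in>carrier G. galois_character G V g * galois_character G V' (inv g \<otimes> u)) = 0"
    by (simp add: sum_distrib_left mult_ac)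
  then show ?thesis using m(1) m'(1) by simp
qed

lemma trivial_rep_irreducible: "irreducible_rep G (trivial_rep :: 'g \<Rightarrow> 'a::field mat)"
proof -
  have dim: "rep_dim G (trivial_rep :: 'g \<Rightarrow> 'a mat) = 1" by (simp add: rep_dim_def trivial_rep_def)
  have "U = {0\<^sub>v 1} \<or> U = carrier_vec 1"
    if U: "VectorSpace.subspace class_ring U (module_vec TYPE('a) 1)" for U
  proof (cases "U \<subseteq> {0\<^sub>v 1}")
    case True
    moreover have "0\<^sub>v 1 \<in> U"
      using U submodule.zero_closed unfolding VectorSpace.subspace_def by (fastforce simp: module_vec_simps)
    ultimately show ?thesis by blast
  next
    case False
    have sub: "U \<subseteq> carrier_vec 1" and sm: "\<And>c v. v \<in> U \<Longrightarrow> c \<cdot>\<^sub>v v \<in> U"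
      using U submodule.subset submodule.smult_closed unfolding VectorSpace.subspace_def
      by (fastforce simp: module_vec_simps)+
    from False obtain u where u: "u \<in> U" "u \<noteq> 0\<^sub>v 1" by blast
    have u0: "u $ 0 \<noteq> 0"
    proof
      assume "u $ 0 = 0"
      then have "u = 0\<^sub>v 1" using u(1) sub by (intro eq_vecI) auto
      then show False using u(2) by simp
    qed
    have "w \<in> U" if "w \<in> carrier_vec 1" for w
    proof -
      have "w = (w $ 0 / u $ 0) \<cdot>\<^sub>v u" using u0 u(1) sub that by (intro eq_vecI) auto
      then show ?thesis using sm[OF u(1)] by metis
    qed
    then show ?thesis using sub by blast
  qed
  then show ?thesis unfolding irreducible_rep_def representation_def dim
    by (auto simp: trivial_rep_def)
qed

text \<open>At the identity, the convolution of the trivial character with that of W is the sum of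
  the latter over G.\<close>

lemma galois_character_sum_zero:
  fixes V :: "'g \<Rightarrow> complex mat"
  assumes W: "irreducible_rep G W" and assoc: "associated_complex_rep G W V"
    and nt: "\<not> rep_iso G W trivial_rep"
  shows "(\<Sum>g\<in>carrier G. galois_character G V g) = 0"
proof -
  obtain m where m: "m > (0::nat)"
    "\<And>g. g \<in> carrier G \<Longrightarrow> of_rat (rep_character W g) = of_nat m * galois_character G V g"
    using associated_complex_rep_galois[OF group_axioms W assoc] by blast
  have triv: "rep_character (trivial_rep :: 'g \<Rightarrow> rat mat) g = 1" for g
    by (simp add: rep_character_def trivial_rep_def)
  have "(\<Sum>g\<in>carrier G. rep_character W g) =
      (\<Sum>g\<in>carrier G. rep_character trivial_rep g * rep_character W (inv g))"
    using sum_inv[of "rep_character W"] by (simp add: triv)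
  also have "\<dots> = 0"
    using character_convolution_noniso[OF W irreducible_repD(1)[OF trivial_rep_irreducible]
        disjI1[OF trivial_rep_irreducible] nt one_closed] by simp
  finally have sum0: "(\<Sum>g\<in>carrier G. rep_character W g) = 0" .
  have "of_nat m * (\<Sum>g\<in>carrier G. galois_character G V g) = (\<Sum>g\<in>carrier G. of_rat (rep_character W g))"
    by (simp add: sum_distrib_left m(2))
  also have "\<dots> = of_rat (\<Sum>g\<in>carrier G. rep_character W g)" by (simp add: of_rat_sum)
  finally have "of_nat m * (\<Sum>g\<in>carrier G. galois_character G V g) = 0" using sum0 by simp
  then show ?thesis using m(1) by simp
qed

end

section \<open>Traces on fixed spaces\<close>

text \<open>Writing U as the image of a matrix makes it finite dimensional by rank and nullity, so
  that \<open>dim\<close> is the size of an actual basis.\<close>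

lemma one_dim_image_line:
  fixes P :: "'a::field mat"
  assumes P: "P \<in> carrier_mat n n" and sub: "VectorSpace.subspace class_ring U (module_vec TYPE('a) n)"
    and img: "(\<lambda>v. P *\<^sub>v v) ` carrier_vec n = U" and dim: "subspace_dim n U = 1"
  shows "\<exists>v\<in>U. v \<noteq> 0\<^sub>v n \<and> (\<forall>u\<in>U. \<exists>c. u = c \<cdot>\<^sub>v v)"
proof -
  interpret V: vec_space "TYPE('a)" n .
  let ?U = "(module_vec TYPE('a) n)\<lparr>carrier := U\<rparr>"
  have vsU: "vectorspace class_ring ?U" by (rule V.subspace_is_vs[OF sub])
  interpret U: vectorspace class_ring ?U by (rule vsU)
  have Uc: "U \<subseteq> carrier_vec n" using submodule.subset[OF VectorSpace.subspace.submod[OF sub]] by (simp add: module_vec_simps)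
  have "(\<lambda>v. P *\<^sub>v v) \<in> LinearCombinations.module_hom class_ring (module_vec TYPE('a) n) ?U"
    unfolding LinearCombinations.module_hom_def using P img
    by (auto simp: module_vec_simps mult_add_distrib_mat_vec[of _ n n] mult_mat_vec[of _ n n])
  then have T: "linear_map class_ring (module_vec TYPE('a) n) ?U (\<lambda>v. P *\<^sub>v v)"
    by (intro linear_map.intro mod_hom.intro mod_hom_axioms.intro vec_vs vec_module vsU vectorspace.axioms(1)[OF vsU])
  have "U.fin_dim" using linear_map.rank_nullity_main(2)[OF T V.fin_dim] img by (simp add: module_vec_simps)
  then obtain B where B: "finite B" "U.basis B" using U.finite_basis_exists by blast
  have "card B = 1" using U.dim_basis[OF B] dim unfolding subspace_dim_def by simp
  then obtain v where v: "B = {v}" by (rule card_1_singletonE)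
  have vU: "v \<in> U" and gen: "U.span {v} = U" and li: "U.lin_indpt {v}"
    using B(2) unfolding v U.basis_def by auto
  have "v \<noteq> 0\<^sub>v n" using U.vs_zero_lin_dep[OF _ li] vU by (auto simp: module_vec_simps)
  moreover have smU: "c \<cdot>\<^sub>v v \<in> U" for c
    using submodule.smult_closed[OF VectorSpace.subspace.submod[OF sub] _ vU, of c] by (simp add: module_vec_simps)
  have "\<exists>c. u = c \<cdot>\<^sub>v v" if uU: "u \<in> U" for u
  proof -
    obtain a where "u = U.lincomb a {v}"
      using uU U.finite_span[of "{v}"] vU gen by auto
    also have "\<dots> = a v \<cdot>\<^sub>v v" unfolding U.lincomb_def using vU Uc smU
      by (subst U.finsum_insert) (auto simp: module_vec_simps)
    finally show ?thesis by blast
  qed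
  ultimately show ?thesis using vU by blast
qed

text \<open>The sum P of all V h has the fixed space as its image and acts there as the scalar |H|.
  If that space is a line, P has rank one, and the trace of a rank one matrix is its eigenvalue on
  the image.\<close>

lemma (in finite_group) fixed_dim_one_character_sum:
  fixes V :: "'g \<Rightarrow> 'a::field_char_0 mat"
  assumes V: "representation G V" and H: "subgroup H G" and dim: "fixed_dim G V H = 1"
  shows "(\<Sum>h\<in>H. rep_character V h) = of_nat (card H)"
proof -
  let ?n = "rep_dim G V"
  note v = representationD[OF V]
  have HG: "h \<in> carrier G" if "h \<in> H" for h using subgroup.mem_carrier[OF H that] .
  have finH: "finite H" using HG fin by (meson finite_subset subsetI)
  have cH: "card H > 0" using finH subgroup.one_closed[OF H] by (metis card_gt_0_iff empty_iff)
  define P where "P = mat ?n ?n (\<lambda>(i, j). \<Sum>h\<in>H. V h $$ (i, j))"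
  have P: "P \<in> carrier_mat ?n ?n" by (simp add: P_def)
  define U where "U = {v \<in> carrier_vec ?n. \<forall>h\<in>H. V h *\<^sub>v v = v}"
  have Pu: "(P *\<^sub>v u) $ i = (\<Sum>h\<in>H. (V h *\<^sub>v u) $ i)" if "u \<in> carrier_vec ?n" "i < ?n" for u i
  proof -
    have "(P *\<^sub>v u) $ i = (\<Sum>j<?n. \<Sum>h\<in>H. V h $$ (i, j) * u $ j)"
      using that by (simp add: P_def scalar_prod_def atLeast0LessThan sum_distrib_right)
    also have "\<dots> = (\<Sum>h\<in>H. \<Sum>j<?n. V h $$ (i, j) * u $ j)" by (rule sum.swap)
    also have "\<dots> = (\<Sum>h\<in>H. (V h *\<^sub>v u) $ i)"
    proof (rule sum.cong[OF refl])
      fix h assume "h \<in> H"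
      then have "V h \<in> carrier_mat ?n ?n" using v(1) HG by blast
      then show "(\<Sum>j<?n. V h $$ (i, j) * u $ j) = (V h *\<^sub>v u) $ i"
        using that by (simp add: scalar_prod_def atLeast0LessThan)
    qed
    finally show ?thesis .
  qed
  have VP: "V h * P = P" if h: "h \<in> H" for h
  proof (rule eq_matI)
    fix i j assume "i < dim_row P" "j < dim_col P"
    then have ij: "i < ?n" "j < ?n" using P by auto
    have "(V h * P) $$ (i, j) = (\<Sum>k<?n. V h $$ (i, k) * (\<Sum>h'\<in>H. V h' $$ (k, j)))"
      using ij by (subst mat_mult_index[OF v(1)[OF HG[OF h]] P]) (simp_all add: P_def)
    also have "\<dots> = (\<Sum>h'\<in>H. \<Sum>k<?n. V h $$ (i, k) * V h' $$ (k, j))"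
      by (subst sum.swap) (simp add: sum_distrib_left)
    also have "\<dots> = (\<Sum>h'\<in>H. V (h \<otimes> h') $$ (i, j))"
      using ij HG h by (intro sum.cong refl) (simp add: v(3) mat_mult_index[OF v(1) v(1)])
    also have "\<dots> = (\<Sum>h'\<in>H. V h' $$ (i, j))"
      by (rule sum.reindex_bij_witness[of _ "\<lambda>x. inv h \<otimes> x" "\<lambda>x. h \<otimes> x"])
        (use h HG H in \<open>auto simp: m_assoc[symmetric] subgroup.m_closed subgroup.m_inv_closed\<close>)
    also have "\<dots> = P $$ (i, j)" using ij by (simp add: P_def)
    finally show "(V h * P) $$ (i, j) = P $$ (i, j)" .
  qed (use v(1)[OF HG[OF h]] P in auto)
  have PU: "P *\<^sub>v u \<in> U" if "u \<in> carrier_vec ?n" for u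
  proof -
    have "V h *\<^sub>v (P *\<^sub>v u) = P *\<^sub>v u" if "h \<in> H" for h
      using assoc_mult_mat_vec[OF v(1)[OF HG[OF that]] P \<open>u \<in> carrier_vec ?n\<close>] VP[OF that] by simp
    then show ?thesis using P that by (auto simp: U_def)
  qed
  have PUid: "P *\<^sub>v u = of_nat (card H) \<cdot>\<^sub>v u" if "u \<in> U" for u
    using that Pu[of u] P by (intro eq_vecI) (auto simp: U_def)
  have dimV: "dim_row (V h) = ?n" if "h \<in> H" for h using v(1)[OF HG[OF that]] by auto
  have zero: "V h *\<^sub>v 0\<^sub>v ?n = 0\<^sub>v ?n" if "h \<in> H" for h
    using v(1)[OF HG[OF that]] by auto
  have sub: "VectorSpace.subspace class_ring U (module_vec TYPE('a) ?n)"
    using v(1)[OF HG] zero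
    by (intro vec_subspaceI)
      (auto simp: U_def mult_add_distrib_mat_vec[of _ ?n ?n] mult_mat_vec[of _ ?n ?n])
  have "(\<lambda>u. P *\<^sub>v u) ` carrier_vec ?n = U"
  proof (intro equalityI subsetI)
    fix u assume u: "u \<in> U"
    then have uc: "u \<in> carrier_vec ?n" by (simp add: U_def)
    have "P *\<^sub>v ((1 / of_nat (card H)) \<cdot>\<^sub>v u) = (1 / of_nat (card H)) \<cdot>\<^sub>v (P *\<^sub>v u)"
      by (rule mult_mat_vec[OF P uc])
    also have "\<dots> = u" using PUid[OF u] cH uc by (intro eq_vecI) auto
    finally show "u \<in> (\<lambda>u. P *\<^sub>v u) ` carrier_vec ?n"
      using uc by (intro image_eqI[of _ _ "(1 / of_nat (card H)) \<cdot>\<^sub>v u"]) auto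
  qed (use PU in auto)
  from one_dim_image_line[OF P sub this] dim obtain w where w: "w \<in> U" "w \<noteq> 0\<^sub>v ?n"
    and line: "\<forall>u\<in>U. \<exists>c. u = c \<cdot>\<^sub>v w"
    unfolding fixed_dim_def U_def[symmetric] by blast
  have wc: "w \<in> carrier_vec ?n" using w(1) by (simp add: U_def)
  have "\<exists>k<?n. w $ k \<noteq> 0"
  proof (rule ccontr)
    assume "\<not> ?thesis"
    then have "w = 0\<^sub>v ?n" using wc by (intro eq_vecI) auto
    with w(2) show False by simp
  qed
  then obtain k where k: "k < ?n" "w $ k \<noteq> 0" by blast
  \<comment> \<open>Every column of P is a multiple of w, so P is the outer product of w and the
    vector of factors c.\<close>
  have "\<exists>c. \<forall>i<?n. P $$ (i, j) = c * w $ i" if j: "j < ?n" for j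
  proof -
    obtain c where "P *\<^sub>v unit_vec ?n j = c \<cdot>\<^sub>v w" using line PU[of "unit_vec ?n j"] by auto
    then have "col P j = c \<cdot>\<^sub>v w" using mult_unit_vec_eq_col[OF P j] by simp
    then have "col P j $ i = c * w $ i" if "i < ?n" for i using that wc by simp
    then show ?thesis using P j by auto
  qed
  then obtain c where c: "\<And>i j. i < ?n \<Longrightarrow> j < ?n \<Longrightarrow> P $$ (i, j) = c j * w $ i" by metis
  \<comment> \<open>\<open>P $$ (k, j) * w $ j\<close> equals \<open>P $$ (j, j) * w $ k\<close>,
    both being \<open>c j * w $ k * w $ j\<close>; the entry k of w is nonzero and can be
    cancelled.\<close>
  have "of_nat (card H) * w $ k = (P *\<^sub>v w) $ k" using PUid[OF w(1)] k(1) wc by simp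
  also have "\<dots> = (\<Sum>j<?n. P $$ (k, j) * w $ j)"
    using P k(1) wc by (simp add: scalar_prod_def atLeast0LessThan)
  also have "\<dots> = (\<Sum>j<?n. P $$ (j, j)) * w $ k"
    unfolding sum_distrib_right using k(1) by (intro sum.cong) (auto simp: c)
  finally have "of_nat (card H) = (\<Sum>j<?n. P $$ (j, j))" using k(2) by simp
  also have "\<dots> = (\<Sum>h\<in>H. rep_character V h)"
  proof -
    have "(\<Sum>j<?n. P $$ (j, j)) = (\<Sum>h\<in>H. \<Sum>j<?n. V h $$ (j, j))"
      by (subst sum.swap) (simp add: P_def)
    also have "\<dots> = (\<Sum>h\<in>H. rep_character V h)"
      using dimV by (intro sum.cong refl) (simp add: rep_character_def)
    finally show ?thesis .
  qed
  finally show ?thesis by simp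
qed

section \<open>Divisors and convolution\<close>

lemma lookup_div_scale: "Poly_Mapping.lookup (div_scale c D) x = c * Poly_Mapping.lookup D x"
  unfolding div_scale_def by (simp add: Poly_Mapping.map.rep_eq when_def)

lemma div_scale_simps [simp]:
  shows "div_scale 0 D = 0" "div_scale c 0 = 0" "div_scale 1 D = D"
    and "div_scale a (div_scale c D) = div_scale (a * c) D"
    and "div_scale c (Poly_Mapping.single x a) = Poly_Mapping.single x (c * a)"
  by (auto intro!: poly_mapping_eqI simp: lookup_div_scale lookup_single when_def)

lemma div_scale_add: "div_scale c (D + E) = div_scale c D + div_scale c E"
  and div_scale_add_left: "div_scale (a + c) D = div_scale a D + div_scale c D"
  by (auto intro!: poly_mapping_eqI simp: lookup_div_scale lookup_add algebra_simps)

lemma div_scale_sum: "div_scale c (\<Sum>i\<in>I. D i) = (\<Sum>i\<in>I. div_scale c (D i))"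
  by (induction I rule: infinite_finite_induct) (simp_all add: div_scale_add)

text \<open>As a map of its own the linear extension can be shown additive, and compositions are
  then computed term by term on sums of points.\<close>

definition corr_extend :: "'p corr \<Rightarrow> 'p divisor \<Rightarrow> 'p divisor" where
  "corr_extend D A = (\<Sum>y\<in>Poly_Mapping.keys A. div_scale (Poly_Mapping.lookup A y) (D y))"

lemma corr_comp_eq_extend: "(D \<circ>\<^sub>c E) x = corr_extend D (E x)"
  by (simp add: corr_comp_def corr_extend_def)

lemma corr_extend_superset:
  assumes "finite S" "Poly_Mapping.keys A \<subseteq> S"
  shows "corr_extend D A = (\<Sum>y\<in>S. div_scale (Poly_Mapping.lookup A y) (D y))"
  unfolding corr_extend_def using assms
  by (intro sum.mono_neutral_left) (auto simp: in_keys_iff)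

lemma corr_extend_add: "corr_extend D (A + B) = corr_extend D A + corr_extend D B"
proof -
  let ?S = "Poly_Mapping.keys A \<union> Poly_Mapping.keys B"
  have "Poly_Mapping.keys (A + B) \<subseteq> ?S" by (rule Poly_Mapping.keys_add)
  then show ?thesis
    by (simp add: corr_extend_superset[of ?S] lookup_add div_scale_add_left sum.distrib)
qed

lemma corr_extend_single: "corr_extend D (Poly_Mapping.single y c) = div_scale c (D y)"
  by (simp add: corr_extend_def)

lemma corr_extend_sum: "corr_extend D (\<Sum>i\<in>I. A i) = (\<Sum>i\<in>I. corr_extend D (A i))"
proof -
  have "corr_extend D 0 = 0" by (simp add: corr_extend_def)
  then show ?thesis by (induction I rule: infinite_finite_induct) (simp_all add: corr_extend_add)
qed

lemma div_degree_superset: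
  assumes "finite S" "Poly_Mapping.keys D \<subseteq> S"
  shows "div_degree D = (\<Sum>y\<in>S. Poly_Mapping.lookup D y)"
  unfolding div_degree_def using assms
  by (intro sum.mono_neutral_left) (auto simp: in_keys_iff)

lemma div_degree_add: "div_degree (D + E) = div_degree D + div_degree E"
proof -
  let ?S = "Poly_Mapping.keys D \<union> Poly_Mapping.keys E"
  have "Poly_Mapping.keys (D + E) \<subseteq> ?S" by (rule Poly_Mapping.keys_add)
  then show ?thesis
    by (simp add: div_degree_superset[of ?S] lookup_add sum.distrib)
qed

lemma div_degree_single [simp]: "div_degree (Poly_Mapping.single y c) = c"
  by (simp add: div_degree_def)

lemma div_degree_sum: "div_degree (\<Sum>i\<in>I. D i) = (\<Sum>i\<in>I. div_degree (D i))"
proof -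
  have "div_degree 0 = 0" by (simp add: div_degree_def)
  then show ?thesis by (induction I rule: infinite_finite_induct) (simp_all add: div_degree_add)
qed

section \<open>Convolution on the group and double cosets\<close>

context finite_group
begin

definition bi_invariant :: "'g set \<Rightarrow> ('g \<Rightarrow> 'a) \<Rightarrow> bool" where
  "bi_invariant H f \<longleftrightarrow> (\<forall>g\<in>carrier G. \<forall>h\<in>H. f (h \<otimes> g) = f g \<and> f (g \<otimes> h) = f g)"

text \<open>The factors stand in the order of composition of correspondences: u is split as
  \<open>(u \<otimes> inv g) \<otimes> g\<close>, and g moves the point first.\<close>

definition convolution :: "('g \<Rightarrow> 'a::comm_ring_1) \<Rightarrow> ('g \<Rightarrow> 'a) \<Rightarrow> 'g \<Rightarrow> 'a" where
  "convolution f e u = (\<Sum>g\<in>carrier G. f (u \<otimes> inv g) * e g)"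

text \<open>This links the definitions, which use representatives, to sums over G, which can be
  translated. Right cosets are chosen because the quotient map by H does not see a left factor
  h.\<close>

lemma sum_double_coset_reps:
  fixes F :: "'g \<Rightarrow> 'a::comm_monoid_add"
  assumes H: "subgroup H G" and reps: "double_coset_reps G H d nn g"
  shows "(\<Sum>x\<in>carrier G. F x) = (\<Sum>i=1..d. \<Sum>j=1..nn i. \<Sum>h\<in>H. F (h \<otimes> g i j))"
proof -
  let ?D = "\<lambda>i. (H #> g i 1) <#> H"
  have gc: "g i j \<in> carrier G" if "i \<in> {1..d}" "j \<in> {1..nn i}" for i j
    using reps that unfolding double_coset_reps_def by blast
  have U: "(\<Union>i\<in>{1..d}. ?D i) = carrier G" and dis: "disjoint_family_on ?D {1..d}"
    using reps unfolding double_coset_reps_def by blast+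
  have U': "(\<Union>j\<in>{1..nn i}. H #> g i j) = ?D i" "disjoint_family_on (\<lambda>j. H #> g i j) {1..nn i}"
    if "i \<in> {1..d}" for i
    using reps that unfolding double_coset_reps_def by blast+
  have HG: "H \<subseteq> carrier G" using subgroup.subset[OF H] .
  have finH: "finite H" using HG fin finite_subset by blast
  have finD: "finite (?D i)" if "i \<in> {1..d}" for i
    using U that fin finite_subset[of "?D i" "carrier G"] by blast
  have finR: "finite (H #> x)" for x using finH by (simp add: r_coset_def)
  have "(\<Sum>x\<in>carrier G. F x) = (\<Sum>i=1..d. \<Sum>x\<in>?D i. F x)"
    unfolding U[symmetric] using finD dis
    by (intro sum.UNION_disjoint) (auto simp: disjoint_family_on_def)
  also have "\<dots> = (\<Sum>i=1..d. \<Sum>j=1..nn i. \<Sum>x\<in>H #> g i j. F x)"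
  proof (rule sum.cong[OF refl])
    fix i assume i: "i \<in> {1..d}"
    show "(\<Sum>x\<in>?D i. F x) = (\<Sum>j=1..nn i. \<Sum>x\<in>H #> g i j. F x)"
      unfolding U'(1)[OF i, symmetric] using finR U'(2)[OF i]
      by (intro sum.UNION_disjoint) (auto simp: disjoint_family_on_def)
  qed
  also have "\<dots> = (\<Sum>i=1..d. \<Sum>j=1..nn i. \<Sum>h\<in>H. F (h \<otimes> g i j))"
  proof (rule sum.cong[OF refl], rule sum.cong[OF refl])
    fix i j assume "i \<in> {1..d}" "j \<in> {1..nn i}"
    then have c: "g i j \<in> carrier G" by (rule gc)
    have "H #> g i j = (\<lambda>h. h \<otimes> g i j) ` H" by (auto simp: r_coset_def)
    moreover have "inj_on (\<lambda>h. h \<otimes> g i j) H" using c HG by (intro inj_onI) (auto simp: subset_iff)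
    ultimately show "(\<Sum>x\<in>H #> g i j. F x) = (\<Sum>h\<in>H. F (h \<otimes> g i j))"
      by (simp add: sum.reindex)
  qed
  finally show ?thesis .
qed

lemma bi_invariant_double_coset_reps:
  assumes H: "subgroup H G" and reps: "double_coset_reps G H d nn g" and f: "bi_invariant H f"
    and i: "i \<in> {1..d}" and x: "x \<in> (H #> g i 1) <#> H"
  shows "f x = f (g i 1)"
proof -
  have "1 \<in> {1..nn i}" "\<forall>j\<in>{1..nn i}. g i j \<in> carrier G"
    using reps i unfolding double_coset_reps_def by auto
  then have g1: "g i 1 \<in> carrier G" by blast
  obtain h h' where x: "x = h \<otimes> g i 1 \<otimes> h'" "h \<in> H" "h' \<in> H"
    using x unfolding set_mult_def r_coset_def by blast
  have "h \<in> carrier G" using subgroup.mem_carrier[OF H x(2)] .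
  then show ?thesis using f x g1 unfolding bi_invariant_def by simp
qed

lemma double_coset_reps_mem:
  assumes H: "subgroup H G" and reps: "double_coset_reps G H d nn g"
    and i: "i \<in> {1..d}" and j: "j \<in> {1..nn i}"
  shows "g i j \<in> carrier G" "g i j \<in> (H #> g i 1) <#> H"
proof -
  show c: "g i j \<in> carrier G" using reps i j unfolding double_coset_reps_def by blast
  have "(\<Union>j\<in>{1..nn i}. H #> g i j) = (H #> g i 1) <#> H"
    using reps i unfolding double_coset_reps_def by blast
  moreover have "g i j \<in> H #> g i j" using rcos_self[OF c H] .
  ultimately show "g i j \<in> (H #> g i 1) <#> H" using j by blast
qed

text \<open>\<open>c / b\<close> is an eigenvalue, with integral eigenvector \<open>\<beta>\<close>, of convolution by the integral function
  \<open>(\<beta> - \<beta> \<one>) / b\<close> over coset representatives.\<close>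

lemma convolution_eigenvalue_int:
  fixes \<beta> :: "'g \<Rightarrow> int" and c :: rat
  assumes H: "subgroup H G" and reps: "double_coset_reps G H d nn g" and \<beta>: "bi_invariant H \<beta>"
    and sum0: "(\<Sum>x\<in>carrier G. \<beta> x) = 0"
    and conv: "\<And>u. u \<in> carrier G \<Longrightarrow>
      (\<Sum>x\<in>carrier G. rat_of_int (\<beta> (u \<otimes> inv x)) * of_int (\<beta> x)) = of_nat (card H) * c * of_int (\<beta> u)"
    and b: "b \<noteq> 0" "\<And>x. x \<in> carrier G \<Longrightarrow> b dvd \<beta> x - \<beta> \<one>" and nz: "\<beta> \<one> \<noteq> 0"
  shows "c / of_int b \<in> \<int>"
proof -
  have HG: "h \<in> carrier G" if "h \<in> H" for h using subgroup.mem_carrier[OF H that] .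
  have finH: "finite H" using HG fin by (meson finite_subset subsetI)
  have cH: "card H > 0" using finH subgroup.one_closed[OF H] by (metis card_gt_0_iff empty_iff)
  \<comment> \<open>b divides differences of values of \<beta>, so subtracting
    \<open>\<beta> \<one>\<close> makes the quotient integral; against an eigenvector of sum 0 the
    subtracted constant acts as zero.\<close>
  define \<alpha> where "\<alpha> = (\<lambda>x. (\<beta> x - \<beta> \<one>) div b)"
  have \<alpha>: "rat_of_int (\<alpha> x) = (of_int (\<beta> x) - of_int (\<beta> \<one>)) / of_int b" if "x \<in> carrier G" for x
    using b(2)[OF that] b(1) by (auto simp: \<alpha>_def elim!: dvdE simp flip: of_int_diff)
  have \<alpha>inv: "\<alpha> (x \<otimes> h) = \<alpha> x" if "x \<in> carrier G" "h \<in> H" for x h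
    using \<beta> that unfolding \<alpha>_def bi_invariant_def by simp
  have \<beta>inv: "\<beta> (h \<otimes> x) = \<beta> x" if "x \<in> carrier G" "h \<in> H" for x h
    using \<beta> that unfolding bi_invariant_def by simp
  have eig: "(\<Sum>i=1..d. \<Sum>j=1..nn i. rat_of_int (\<alpha> (u \<otimes> inv g i j)) * of_int (\<beta> (g i j))) =
      c / of_int b * of_int (\<beta> u)" if u: "u \<in> carrier G" for u
  proof -
    \<comment> \<open>Along \<open>H #> g i j\<close> the summand is constant, as \<alpha> is
      invariant on the right and \<beta> on the left; the factor |H| counts the elements.\<close>
    have "of_nat (card H) * (\<Sum>i=1..d. \<Sum>j=1..nn i. rat_of_int (\<alpha> (u \<otimes> inv g i j)) * of_int (\<beta> (g i j))) =
      (\<Sum>i=1..d. \<Sum>j=1..nn i. \<Sum>h\<in>H. rat_of_int (\<alpha> (u \<otimes> inv (h \<otimes> g i j))) * of_int (\<beta> (h \<otimes> g i j)))"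
      unfolding sum_distrib_left
    proof (intro sum.cong refl)
      fix i j assume ij: "i \<in> {1..d}" "j \<in> {1..nn i}"
      note gc = double_coset_reps_mem(1)[OF H reps ij]
      have "rat_of_int (\<alpha> (u \<otimes> inv (h \<otimes> g i j))) * of_int (\<beta> (h \<otimes> g i j)) =
        rat_of_int (\<alpha> (u \<otimes> inv g i j)) * of_int (\<beta> (g i j))" if h: "h \<in> H" for h
      proof -
        have "u \<otimes> inv (h \<otimes> g i j) = u \<otimes> inv g i j \<otimes> inv h"
          using gc u HG[OF h] by (simp add: inv_mult_group m_assoc)
        then show ?thesis using \<alpha>inv[of "u \<otimes> inv g i j" "inv h"] \<beta>inv[OF gc h] gc u
            subgroup.m_inv_closed[OF H h] by simp
      qed
      then show "of_nat (card H) * (rat_of_int (\<alpha> (u \<otimes> inv g i j)) * of_int (\<beta> (g i j))) =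
        (\<Sum>h\<in>H. rat_of_int (\<alpha> (u \<otimes> inv (h \<otimes> g i j))) * of_int (\<beta> (h \<otimes> g i j)))" by simp
    qed
    also have "\<dots> = (\<Sum>x\<in>carrier G. rat_of_int (\<alpha> (u \<otimes> inv x)) * of_int (\<beta> x))"
      by (rule sum_double_coset_reps[OF H reps, symmetric])
    also have "\<dots> = (\<Sum>x\<in>carrier G. (rat_of_int (\<beta> (u \<otimes> inv x)) * of_int (\<beta> x) - of_int (\<beta> \<one>) * of_int (\<beta> x)) / of_int b)"
      using u by (intro sum.cong refl) (simp add: \<alpha> algebra_simps)
    also have "\<dots> = ((\<Sum>x\<in>carrier G. rat_of_int (\<beta> (u \<otimes> inv x)) * of_int (\<beta> x)) -
        of_int (\<beta> \<one>) * of_int (\<Sum>x\<in>carrier G. \<beta> x)) / of_int b"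
      by (simp add: sum_subtractf sum_distrib_left flip: sum_divide_distrib)
    also have "\<dots> = of_nat (card H) * (c / of_int b * of_int (\<beta> u))"
      using conv[OF u] sum0 by simp
    finally have eq: "of_nat (card H) * (\<Sum>i=1..d. \<Sum>j=1..nn i. rat_of_int (\<alpha> (u \<otimes> inv g i j)) * of_int (\<beta> (g i j))) =
      of_nat (card H) * (c / of_int b * of_int (\<beta> u))" .
    have "rat_of_nat (card H) \<noteq> 0" using cH by simp
    from mult_left_cancel[OF this] eq show ?thesis by blast
  qed
  \<comment> \<open>Each use of \<open>eig\<close> trades one power of c/b for a sum with integral
    coefficients \<alpha>, so all powers of c/b have the common denominator
    \<open>\<beta> \<one>\<close>.\<close>
  have "(c / of_int b) ^ m * of_int (\<beta> u) \<in> \<int>" if "u \<in> carrier G" for m u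
    using that
  proof (induction m arbitrary: u)
    case (Suc m)
    have "(c / of_int b) ^ Suc m * of_int (\<beta> u) = (c / of_int b) ^ m *
        (\<Sum>i=1..d. \<Sum>j=1..nn i. rat_of_int (\<alpha> (u \<otimes> inv g i j)) * of_int (\<beta> (g i j)))"
      unfolding eig[OF Suc.prems] by simp
    also have "\<dots> = (\<Sum>i=1..d. \<Sum>j=1..nn i. rat_of_int (\<alpha> (u \<otimes> inv g i j)) *
        ((c / of_int b) ^ m * of_int (\<beta> (g i j))))"
      unfolding sum_distrib_left by (intro sum.cong refl) simp
    also have "\<dots> \<in> \<int>"
    proof (intro Ints_sum)
      fix i j assume "i \<in> {1..d}" "j \<in> {1..nn i}"
      then show "rat_of_int (\<alpha> (u \<otimes> inv g i j)) * ((c / of_int b) ^ m * of_int (\<beta> (g i j))) \<in> \<int>"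
        using Suc.IH[OF double_coset_reps_mem(1)[OF H reps]] by (intro Ints_mult[OF Ints_of_int]) auto
    qed
    finally show ?case .
  qed simp
  then show ?thesis using rat_int_of_powers[OF nz, of "c / of_int b"] one_closed by blast
qed

text \<open>In the convolution each pair (h, k) contributes a convolution of \<psi> with itself,
  equal to c times \<open>\<psi> ((h \<otimes> k) \<otimes> inv u)\<close>. Summing over k gives c
  B(u) for every h, hence the factor |H|. The class property lets h pass from one side to the
  other.\<close>

lemma averaged_class_function:
  fixes \<psi> :: "'g \<Rightarrow> 'a::comm_ring_1"
  assumes H: "subgroup H G"
    and cl: "\<And>x y. x \<in> carrier G \<Longrightarrow> y \<in> carrier G \<Longrightarrow> \<psi> (x \<otimes> y) = \<psi> (y \<otimes> x)"
  defines "B \<equiv> \<lambda>g. \<Sum>h\<in>H. \<psi> (h \<otimes> inv g)"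
  shows "bi_invariant H B"
    and "(\<Sum>g\<in>carrier G. B g) = of_nat (card H) * (\<Sum>g\<in>carrier G. \<psi> g)"
    and "\<And>u. u \<in> carrier G \<Longrightarrow>
      (\<And>u. u \<in> carrier G \<Longrightarrow> (\<Sum>g\<in>carrier G. \<psi> g * \<psi> (inv g \<otimes> u)) = c * \<psi> u) \<Longrightarrow>
      convolution B B u = of_nat (card H) * c * B u"
proof -
  have HG: "h \<in> carrier G" if "h \<in> H" for h using subgroup.mem_carrier[OF H that] .
  have shift_r: "(\<Sum>h\<in>H. F (h \<otimes> a)) = (\<Sum>h\<in>H. F h)" if "a \<in> H" for F :: "'g \<Rightarrow> 'a" and a
    by (rule sum.reindex_bij_witness[of _ "\<lambda>x. x \<otimes> inv a" "\<lambda>x. x \<otimes> a"])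
      (use that HG H in \<open>auto simp: m_assoc subgroup.m_closed subgroup.m_inv_closed\<close>)
  have shift_l: "(\<Sum>h\<in>H. F (a \<otimes> h)) = (\<Sum>h\<in>H. F h)" if "a \<in> H" for F :: "'g \<Rightarrow> 'a" and a
    by (rule sum.reindex_bij_witness[of _ "\<lambda>x. inv a \<otimes> x" "\<lambda>x. a \<otimes> x"])
      (use that HG H in \<open>auto simp: m_assoc[symmetric] subgroup.m_closed subgroup.m_inv_closed\<close>)
  show "bi_invariant H B"
    unfolding bi_invariant_def
  proof (intro ballI conjI)
    fix g a assume g: "g \<in> carrier G" and a: "a \<in> H"
    note aG = HG[OF a] and a' = subgroup.m_inv_closed[OF H a]
    have "B (a \<otimes> g) = (\<Sum>h\<in>H. \<psi> ((inv a \<otimes> h) \<otimes> inv g))"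
      unfolding B_def
    proof (rule sum.cong[OF refl])
      fix h assume "h \<in> H"
      then have h: "h \<in> carrier G" by (rule HG)
      have "h \<otimes> inv (a \<otimes> g) = (h \<otimes> inv g) \<otimes> inv a" using g aG h by (simp add: inv_mult_group m_assoc)
      also have "\<psi> \<dots> = \<psi> (inv a \<otimes> (h \<otimes> inv g))" using g aG h by (intro cl) auto
      finally show "\<psi> (h \<otimes> inv (a \<otimes> g)) = \<psi> ((inv a \<otimes> h) \<otimes> inv g)" using g aG h by (simp add: m_assoc)
    qed
    also have "\<dots> = B g" unfolding B_def by (rule shift_l[OF a', of "\<lambda>x. \<psi> (x \<otimes> inv g)"])
    finally show "B (a \<otimes> g) = B g" .
    have "B (g \<otimes> a) = (\<Sum>h\<in>H. \<psi> ((h \<otimes> inv a) \<otimes> inv g))"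
      unfolding B_def using g aG HG by (intro sum.cong) (auto simp: inv_mult_group m_assoc)
    also have "\<dots> = B g" unfolding B_def by (rule shift_r[OF a', of "\<lambda>x. \<psi> (x \<otimes> inv g)"])
    finally show "B (g \<otimes> a) = B g" .
  qed
  have "(\<Sum>g\<in>carrier G. B g) = (\<Sum>h\<in>H. \<Sum>g\<in>carrier G. \<psi> (h \<otimes> inv g))"
    unfolding B_def by (rule sum.swap)
  also have "\<dots> = (\<Sum>h\<in>H. \<Sum>g\<in>carrier G. \<psi> g)"
  proof (rule sum.cong[OF refl])
    fix h assume h: "h \<in> H"
    show "(\<Sum>g\<in>carrier G. \<psi> (h \<otimes> inv g)) = (\<Sum>g\<in>carrier G. \<psi> g)"
      using sum_inv[of "\<lambda>g. \<psi> (h \<otimes> g)"] sum_mult_left[OF HG[OF h], of \<psi>] by simp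
  qed
  finally show "(\<Sum>g\<in>carrier G. B g) = of_nat (card H) * (\<Sum>g\<in>carrier G. \<psi> g)" by simp
  fix u assume u: "u \<in> carrier G"
    and conv: "\<And>u. u \<in> carrier G \<Longrightarrow> (\<Sum>g\<in>carrier G. \<psi> g * \<psi> (inv g \<otimes> u)) = c * \<psi> u"
  have summand: "(\<Sum>g\<in>carrier G. \<psi> (h \<otimes> inv (u \<otimes> inv g)) * \<psi> (k \<otimes> inv g)) = c * \<psi> ((h \<otimes> k) \<otimes> inv u)"
    if h: "h \<in> H" and k: "k \<in> H" for h k
  proof -
    note hG = HG[OF h] and kG = HG[OF k]
    let ?F = "\<lambda>g. \<psi> (h \<otimes> inv (u \<otimes> inv g)) * \<psi> (k \<otimes> inv g)"
    \<comment> \<open>After the substitution the factor \<open>k \<otimes> inv g\<close> becomes the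
      new summation variable.\<close>
    have "(\<Sum>g\<in>carrier G. ?F g) = (\<Sum>g\<in>carrier G. ?F (inv g \<otimes> k))"
      using sum_mult_right[OF kG, of ?F] sum_inv[of "\<lambda>g. ?F (g \<otimes> k)"] by simp
    also have "\<dots> = (\<Sum>x\<in>carrier G. \<psi> x * \<psi> (inv x \<otimes> (k \<otimes> inv u \<otimes> h)))"
    proof (rule sum.cong[OF refl])
      fix x assume x: "x \<in> carrier G"
      have 1: "k \<otimes> inv (inv x \<otimes> k) = x"
        using x kG by (simp add: inv_mult_group m_assoc[symmetric])
      have "h \<otimes> inv (u \<otimes> inv (inv x \<otimes> k)) = h \<otimes> (inv x \<otimes> k \<otimes> inv u)"
        using x u kG hG by (simp add: inv_mult_group m_assoc)
      also have "\<psi> \<dots> = \<psi> ((inv x \<otimes> k \<otimes> inv u) \<otimes> h)" using x u kG hG by (intro cl) auto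
      also have "(inv x \<otimes> k \<otimes> inv u) \<otimes> h = inv x \<otimes> (k \<otimes> inv u \<otimes> h)"
        using x u kG hG by (simp add: m_assoc)
      finally show "?F (inv x \<otimes> k) = \<psi> x * \<psi> (inv x \<otimes> (k \<otimes> inv u \<otimes> h))"
        using x kG unfolding 1 by (simp add: mult.commute)
    qed
    also have "\<dots> = c * \<psi> ((k \<otimes> inv u) \<otimes> h)" using u kG hG by (intro conv) auto
    also have "\<psi> ((k \<otimes> inv u) \<otimes> h) = \<psi> (h \<otimes> (k \<otimes> inv u))" using u kG hG by (intro cl) auto
    finally show ?thesis using u kG hG by (simp add: m_assoc)
  qed
  have "convolution B B u = (\<Sum>g\<in>carrier G. \<Sum>h\<in>H. \<Sum>k\<in>H. \<psi> (h \<otimes> inv (u \<otimes> inv g)) * \<psi> (k \<otimes> inv g))"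
    by (simp add: convolution_def B_def sum_product)
  also have "\<dots> = (\<Sum>h\<in>H. \<Sum>k\<in>H. \<Sum>g\<in>carrier G. \<psi> (h \<otimes> inv (u \<otimes> inv g)) * \<psi> (k \<otimes> inv g))"
    by (subst sum.swap, rule sum.cong[OF refl], rule sum.swap)
  also have "\<dots> = (\<Sum>h\<in>H. \<Sum>k\<in>H. c * \<psi> ((h \<otimes> k) \<otimes> inv u))"
    using summand by (intro sum.cong refl)
  also have "\<dots> = (\<Sum>h\<in>H. c * B u)"
  proof (rule sum.cong[OF refl])
    fix h assume "h \<in> H"
    then show "(\<Sum>k\<in>H. c * \<psi> ((h \<otimes> k) \<otimes> inv u)) = c * B u"
      using shift_l[of h "\<lambda>x. \<psi> (x \<otimes> inv u)"] by (simp add: B_def flip: sum_distrib_left)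
  qed
  finally show "convolution B B u = of_nat (card H) * c * B u" by (simp add: mult.assoc)
qed

end

section \<open>Correspondences represented by functions on the group\<close>

lemma single_sum:
  "Poly_Mapping.single x (\<Sum>i\<in>I. f i) = (\<Sum>i\<in>I. Poly_Mapping.single x (f i))"
  by (induction I rule: infinite_finite_induct) (simp_all add: single_add)

text \<open>Correspondences on Z/H see the geometry through the action and the fibres of \<pi>, so
  points may be of any type here.\<close>

locale quotient_action = finite_group G for G :: "'g monoid" (structure) +
  fixes H :: "'g set" and Z :: "'p set" and act :: "'g \<Rightarrow> 'p \<Rightarrow> 'p" and \<pi> :: "'p \<Rightarrow> 'p"
  assumes H: "subgroup H G" and action: "group_action G Z act"
    and fibres: "\<And>z z'. z \<in> Z \<Longrightarrow> z' \<in> Z \<Longrightarrow> \<pi> z = \<pi> z' \<longleftrightarrow> (\<exists>a\<in>H. z' = act a z)"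
begin

lemma HG: "h \<in> H \<Longrightarrow> h \<in> carrier G"
  using subgroup.mem_carrier[OF H] .

lemma finite_H: "finite H"
  using HG fin by (meson finite_subset subsetI)

lemma card_H: "card H > 0"
  using finite_H subgroup.one_closed[OF H] by (metis card_gt_0_iff empty_iff)

lemma act_closed: "x \<in> carrier G \<Longrightarrow> z \<in> Z \<Longrightarrow> act x z \<in> Z"
  using group_action.element_image[OF action] by blast

lemma act_mult: "x \<in> carrier G \<Longrightarrow> y \<in> carrier G \<Longrightarrow> z \<in> Z \<Longrightarrow> act (x \<otimes> y) z = act x (act y z)"
  using group_action.composition_rule[OF action] by blast

lemma \<pi>_act: "h \<in> H \<Longrightarrow> z \<in> Z \<Longrightarrow> \<pi> (act h z) = \<pi> z"
  using fibres[of z "act h z"] act_closed[OF HG] by metis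

text \<open>Summing over G avoids a choice of representatives and makes translations permute the
  index set; the price is that each coset \<open>H #> g\<close> is met |H| times.\<close>

definition orbit_divisor :: "('g \<Rightarrow> rat) \<Rightarrow> 'p \<Rightarrow> 'p divisor" where
  "orbit_divisor f z = (\<Sum>g\<in>carrier G. Poly_Mapping.single (\<pi> (act g z)) (f g))"

text \<open>Different f may represent the same D, since f counts through its sums over right cosets
  of H. A vanishing f forces D to vanish, which is the direction used for the cubic.\<close>

definition represents :: "('g \<Rightarrow> rat) \<Rightarrow> 'p corr \<Rightarrow> bool" where
  "represents f D \<longleftrightarrow> (\<forall>z\<in>Z. D (\<pi> z) = orbit_divisor f z)"

lemma represents_add: "represents f D \<Longrightarrow> represents e E \<Longrightarrow> represents (\<lambda>g. f g + e g) (D +\<^sub>c E)"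
  by (simp add: represents_def orbit_divisor_def corr_add_def single_add sum.distrib)

lemma represents_diff: "represents f D \<Longrightarrow> represents e E \<Longrightarrow> represents (\<lambda>g. f g - e g) (D -\<^sub>c E)"
  by (simp add: represents_def orbit_divisor_def corr_diff_def single_diff sum_subtractf)

lemma represents_scale: "represents f D \<Longrightarrow> represents (\<lambda>g. c * f g) (c \<cdot>\<^sub>c D)"
  by (simp add: represents_def orbit_divisor_def corr_scale_def div_scale_sum)

text \<open>The condition on D holds at every preimage, so D at \<pi>(g z) can be read off from g z
  itself, without a choice.\<close>

lemma represents_comp:
  assumes D: "represents f D" and E: "represents e E"
  shows "represents (convolution f e) (D \<circ>\<^sub>c E)"
  unfolding represents_def
proof
  fix z assume z: "z \<in> Z"
  have "(D \<circ>\<^sub>c E) (\<pi> z) = (\<Sum>g\<in>carrier G. div_scale (e g) (D (\<pi> (act g z))))"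
    using E z unfolding represents_def
    by (simp add: corr_comp_eq_extend orbit_divisor_def corr_extend_sum corr_extend_single)
  also have "\<dots> = (\<Sum>g\<in>carrier G. \<Sum>x\<in>carrier G. Poly_Mapping.single (\<pi> (act x z)) (f (x \<otimes> inv g) * e g))"
  proof (rule sum.cong[OF refl])
    fix g assume g: "g \<in> carrier G"
    let ?F = "\<lambda>x. Poly_Mapping.single (\<pi> (act x z)) (f (x \<otimes> inv g) * e g)"
    have "div_scale (e g) (D (\<pi> (act g z))) = (\<Sum>x\<in>carrier G. Poly_Mapping.single (\<pi> (act x (act g z))) (e g * f x))"
      using D act_closed[OF g z] unfolding represents_def by (simp add: orbit_divisor_def div_scale_sum)
    also have "\<dots> = (\<Sum>x\<in>carrier G. ?F (x \<otimes> g))"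
      using g z by (intro sum.cong refl) (simp add: act_mult m_assoc mult.commute)
    also have "\<dots> = (\<Sum>x\<in>carrier G. ?F x)" by (rule sum_mult_right[OF g])
    finally show "div_scale (e g) (D (\<pi> (act g z))) = (\<Sum>x\<in>carrier G. ?F x)" .
  qed
  also have "\<dots> = orbit_divisor (convolution f e) z"
    unfolding orbit_divisor_def convolution_def
    by (subst sum.swap, rule sum.cong[OF refl]) (simp add: single_sum)
  finally show "(D \<circ>\<^sub>c E) (\<pi> z) = orbit_divisor (convolution f e) z" .
qed

lemma sum_H_if: "(\<Sum>g\<in>carrier G. if g \<in> H then F g else 0) = (\<Sum>h\<in>H. F h)"
  for F :: "'g \<Rightarrow> 'a::comm_monoid_add"
  using HG fin by (intro sum.mono_neutral_cong_right) auto

lemma represents_diag: "represents (\<lambda>g. if g \<in> H then 1 / of_nat (card H) else 0) \<Delta>\<^sub>c"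
  unfolding represents_def
proof
  fix z assume z: "z \<in> Z"
  have "orbit_divisor (\<lambda>g. if g \<in> H then 1 / of_nat (card H) else 0) z =
      (\<Sum>g\<in>carrier G. if g \<in> H then Poly_Mapping.single (\<pi> (act g z)) (1 / of_nat (card H)) else 0)"
    unfolding orbit_divisor_def by (intro sum.cong) auto
  also have "\<dots> = (\<Sum>h\<in>H. Poly_Mapping.single (\<pi> z) (1 / of_nat (card H)))"
    using z by (simp add: sum_H_if \<pi>_act)
  also have "\<dots> = Poly_Mapping.single (\<pi> z) 1"
    using card_H by (simp flip: single_sum)
  finally show "\<Delta>\<^sub>c (\<pi> z) = orbit_divisor (\<lambda>g. if g \<in> H then 1 / of_nat (card H) else 0) z"
    by (simp add: corr_diag_def)
qed

lemma orbit_divisor_fibre: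
  assumes f: "bi_invariant H f" and z: "z \<in> Z" and a: "a \<in> H"
  shows "orbit_divisor f (act a z) = orbit_divisor f z"
proof -
  let ?F = "\<lambda>x. Poly_Mapping.single (\<pi> (act x z)) (f x)"
  have "orbit_divisor f (act a z) = (\<Sum>g\<in>carrier G. ?F (g \<otimes> a))"
    unfolding orbit_divisor_def using f z a HG[OF a]
    by (intro sum.cong refl) (simp add: act_mult bi_invariant_def)
  also have "\<dots> = orbit_divisor f z"
    unfolding orbit_divisor_def by (rule sum_mult_right[OF HG[OF a]])
  finally show ?thesis .
qed

lemma represents_coset_corr:
  assumes reps: "double_coset_reps G H d nn g" and f: "bi_invariant H f"
    and c: "\<And>i. i \<in> {1..d} \<Longrightarrow> f (g i 1) = of_int (c i)"
  shows "represents (\<lambda>x. f x / of_nat (card H)) (coset_corr Z act \<pi> d nn g c)"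
  unfolding represents_def
proof
  fix z assume z: "z \<in> Z"
  let ?e = "\<lambda>x. f x / of_nat (card H)"
  have e: "bi_invariant H ?e" using f unfolding bi_invariant_def by auto
  \<comment> \<open>This is the preimage picked inside \<open>coset_corr\<close>. It lies in the
    H-orbit of z, and right invariance of f makes the orbit divisors of both points equal.\<close>
  define z0 where "z0 = (SOME z'. z' \<in> Z \<and> \<pi> z' = \<pi> z)"
  have z0: "z0 \<in> Z" "\<pi> z0 = \<pi> z"
    unfolding z0_def using someI[of "\<lambda>z'. z' \<in> Z \<and> \<pi> z' = \<pi> z" z] z by auto
  then obtain a where a: "a \<in> H" "z = act a z0" using fibres[OF z0(1) z] by auto
  have "orbit_divisor ?e z = orbit_divisor ?e z0" using orbit_divisor_fibre[OF e z0(1) a(1)] a(2) by simp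
  also have "\<dots> = (\<Sum>i=1..d. \<Sum>j=1..nn i. \<Sum>h\<in>H. Poly_Mapping.single (\<pi> (act (h \<otimes> g i j) z0)) (?e (h \<otimes> g i j)))"
    unfolding orbit_divisor_def by (rule sum_double_coset_reps[OF H reps])
  also have "\<dots> = (\<Sum>i=1..d. \<Sum>j=1..nn i. Poly_Mapping.single (\<pi> (act (g i j) z0)) (of_int (c i)))"
  proof (rule sum.cong[OF refl], rule sum.cong[OF refl])
    fix i j assume ij: "i \<in> {1..d}" "j \<in> {1..nn i}"
    note gij = double_coset_reps_mem[OF H reps ij]
    have "f (g i j) = of_int (c i)"
      using bi_invariant_double_coset_reps[OF H reps f ij(1) gij(2)] c[OF ij(1)] by simp
    then have "Poly_Mapping.single (\<pi> (act (h \<otimes> g i j) z0)) (?e (h \<otimes> g i j)) =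
        Poly_Mapping.single (\<pi> (act (g i j) z0)) (of_int (c i) / of_nat (card H))" if "h \<in> H" for h
      using f that gij(1) z0(1) unfolding bi_invariant_def
      by (simp add: act_mult HG \<pi>_act act_closed)
    then have "(\<Sum>h\<in>H. Poly_Mapping.single (\<pi> (act (h \<otimes> g i j) z0)) (?e (h \<otimes> g i j))) =
        (\<Sum>h\<in>H. Poly_Mapping.single (\<pi> (act (g i j) z0)) (of_int (c i) / of_nat (card H)))"
      by (intro sum.cong refl)
    also have "\<dots> = Poly_Mapping.single (\<pi> (act (g i j) z0)) (of_int (c i))"
      using card_H by (simp flip: single_sum)
    finally show "(\<Sum>h\<in>H. Poly_Mapping.single (\<pi> (act (h \<otimes> g i j) z0)) (?e (h \<otimes> g i j))) =
        Poly_Mapping.single (\<pi> (act (g i j) z0)) (of_int (c i))" .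
  qed
  also have "\<dots> = coset_corr Z act \<pi> d nn g c (\<pi> z)"
    by (simp add: coset_corr_def z0_def[symmetric] div_scale_sum)
  finally show "coset_corr Z act \<pi> d nn g c (\<pi> z) = orbit_divisor ?e z" ..
qed

text \<open>The degree of an orbit divisor does not depend on the point, and a nonempty Z makes the
  definite description in \<open>corr_degree\<close> unique.\<close>

lemma represents_degree:
  assumes "represents f D" and "Z \<noteq> {}"
  shows "corr_degree (\<pi> ` Z) D = (\<Sum>g\<in>carrier G. f g)"
proof -
  have "div_degree (D x) = (\<Sum>g\<in>carrier G. f g)" if "x \<in> \<pi> ` Z" for x
    using assms(1) that unfolding represents_def orbit_divisor_def by (auto simp: div_degree_sum)
  then show ?thesis unfolding corr_degree_def using assms(2)
    by (intro the_equality) auto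
qed

lemma represents_zero:
  assumes "represents f D" "\<And>g. g \<in> carrier G \<Longrightarrow> f g = 0" "z \<in> Z"
  shows "D (\<pi> z) = 0"
  using assms unfolding represents_def orbit_divisor_def by simp

text \<open>The normalised indicator of H, which represents the diagonal, is a right unit on
  functions that are H-invariant on the right.\<close>

lemma convolution_diag:
  assumes f: "\<And>h. h \<in> H \<Longrightarrow> f (u \<otimes> h) = f u"
  shows "convolution f (\<lambda>g. if g \<in> H then 1 / of_nat (card H) else 0) u = (f u :: rat)"
proof -
  have "convolution f (\<lambda>g. if g \<in> H then 1 / of_nat (card H) else 0) u =
      (\<Sum>g\<in>carrier G. if g \<in> H then f (u \<otimes> inv g) / of_nat (card H) else 0)"
    unfolding convolution_def by (intro sum.cong) auto
  also have "\<dots> = f u"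
    using f[OF subgroup.m_inv_closed[OF H]] card_H by (simp add: sum_H_if)
  finally show ?thesis .
qed

text \<open>With \<open>A = K - \<Delta>\<close> one has \<open>A\<^sup>2 = - q A\<close> modulo multiples of the trace correspondence.\<close>

lemma kanev_cubic:
  fixes \<beta> :: "'g \<Rightarrow> rat"
  assumes reps: "double_coset_reps G H d nn g" and \<beta>: "bi_invariant H \<beta>"
    and b: "\<And>i. i \<in> {1..d} \<Longrightarrow> \<beta> (g i 1) = of_int (b i)"
    and sum0: "(\<Sum>x\<in>carrier G. \<beta> x) = 0"
    and conv: "\<And>u. u \<in> carrier G \<Longrightarrow> convolution \<beta> \<beta> u = of_nat (card H) * c * \<beta> u"
    and q: "q = c / of_int (b_gcd d b)" and nz: "b_gcd d b \<noteq> 0" and z: "z \<in> Z"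
  defines "K \<equiv> kanev_corr Z act \<pi> d nn g b"
  shows "((K -\<^sub>c \<Delta>\<^sub>c) \<circ>\<^sub>c (K +\<^sub>c (q - 1) \<cdot>\<^sub>c \<Delta>\<^sub>c) \<circ>\<^sub>c (K -\<^sub>c corr_degree (\<pi> ` Z) K \<cdot>\<^sub>c \<Delta>\<^sub>c)) (\<pi> z) = 0"
proof -
  let ?B = "rat_of_int (b_gcd d b)" and ?h = "rat_of_nat (card H)" and ?N = "rat_of_nat (card (carrier G))"
  \<comment> \<open>\<gamma> is the coefficient of the trace correspondence in K, A will represent K
    - \<Delta>, and m is the degree of K.\<close>
  define \<gamma> where "\<gamma> = of_int (b 1) / ?B - 1"
  define \<delta> where "\<delta> = (\<lambda>g. if g \<in> H then 1 / ?h else 0)"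
  define A where "A = (\<lambda>g. \<gamma> / ?h - \<beta> g / (?B * ?h))"
  define m where "m = 1 + \<gamma> * ?N / ?h"
  have h: "?h \<noteq> 0" using card_H by simp
  have D: "represents \<delta> \<Delta>\<^sub>c" unfolding \<delta>_def by (rule represents_diag)
  have "represents (\<lambda>x. 1 / ?h) (trace_corr Z act \<pi> d nn g)"
    unfolding trace_corr_def using represents_coset_corr[OF reps, of "\<lambda>x. 1" "\<lambda>i. 1"]
    by (simp add: bi_invariant_def)
  from represents_add[OF represents_diff[OF D represents_scale[OF represents_coset_corr[OF reps \<beta> b]]]
      represents_scale[OF this]]
  have "represents (\<lambda>g. \<delta> g - 1 / ?B * (\<beta> g / ?h) + \<gamma> * (1 / ?h)) K"
    unfolding K_def kanev_corr_def \<gamma>_def by blast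
  also have "(\<lambda>g. \<delta> g - 1 / ?B * (\<beta> g / ?h) + \<gamma> * (1 / ?h)) = (\<lambda>g. A g + \<delta> g)"
    by (simp add: A_def fun_eq_iff)
  finally have K: "represents (\<lambda>g. A g + \<delta> g) K" .
  have sum\<delta>: "(\<Sum>g\<in>carrier G. \<delta> g) = 1" unfolding \<delta>_def using h by (simp add: sum_H_if)
  have "(\<Sum>g\<in>carrier G. A g) = \<gamma> * ?N / ?h - (\<Sum>g\<in>carrier G. \<beta> g) / (?B * ?h)"
    by (simp add: A_def sum_subtractf sum_divide_distrib)
  then have sumA: "(\<Sum>g\<in>carrier G. A g) = m - 1" by (simp add: m_def sum0)
  have deg: "corr_degree (\<pi> ` Z) K = m"
    using represents_degree[OF K] z sumA sum\<delta> by (auto simp: sum.distrib)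
  have "represents A (K -\<^sub>c \<Delta>\<^sub>c)" using represents_diff[OF K D] by simp
  moreover have "represents (\<lambda>g. A g + q * \<delta> g) (K +\<^sub>c (q - 1) \<cdot>\<^sub>c \<Delta>\<^sub>c)"
    using represents_add[OF K represents_scale[OF D, of "q - 1"]] by (simp add: algebra_simps)
  moreover have "represents (\<lambda>g. A g + (1 - m) * \<delta> g) (K -\<^sub>c m \<cdot>\<^sub>c \<Delta>\<^sub>c)"
    using represents_diff[OF K represents_scale[OF D, of m]] by (simp add: algebra_simps)
  ultimately have rep: "represents (convolution (convolution A (\<lambda>g. A g + q * \<delta> g)) (\<lambda>g. A g + (1 - m) * \<delta> g))
      ((K -\<^sub>c \<Delta>\<^sub>c) \<circ>\<^sub>c (K +\<^sub>c (q - 1) \<cdot>\<^sub>c \<Delta>\<^sub>c) \<circ>\<^sub>c (K -\<^sub>c m \<cdot>\<^sub>c \<Delta>\<^sub>c))"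
    by (intro represents_comp)
  \<comment> \<open>The constant function C represents |H| C times the trace correspondence; it is
    what remains of the quadratic product once \<beta> cancels.\<close>
  define C where "C = \<gamma>\<^sup>2 * ?N / ?h\<^sup>2 + q * \<gamma> / ?h"
  have quad: "convolution A (\<lambda>g. A g + q * \<delta> g) u = C" if u: "u \<in> carrier G" for u
  proof -
    have su: "(\<Sum>g\<in>carrier G. \<beta> (u \<otimes> inv g)) = 0"
      using sum_inv[of "\<lambda>g. \<beta> (u \<otimes> g)"] sum_mult_left[OF u, of \<beta>] sum0 by simp
    have "A (u \<otimes> x) = A u" if "x \<in> H" for x using \<beta> u that unfolding A_def bi_invariant_def by simp
    then have Ad: "convolution A \<delta> u = A u" unfolding \<delta>_def by (rule convolution_diag)
    have "convolution A A u = (\<Sum>g\<in>carrier G. (\<gamma> / ?h)\<^sup>2 - \<gamma> / (?B * ?h\<^sup>2) * \<beta> (u \<otimes> inv g)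
        - \<gamma> / (?B * ?h\<^sup>2) * \<beta> g + 1 / (?B * ?h)\<^sup>2 * (\<beta> (u \<otimes> inv g) * \<beta> g))"
      unfolding convolution_def A_def using h nz
      by (intro sum.cong refl) (simp add: field_simps power2_eq_square)
    also have "\<dots> = ?N * (\<gamma> / ?h)\<^sup>2 - \<gamma> / (?B * ?h\<^sup>2) * (\<Sum>g\<in>carrier G. \<beta> (u \<otimes> inv g))
        - \<gamma> / (?B * ?h\<^sup>2) * (\<Sum>g\<in>carrier G. \<beta> g) + 1 / (?B * ?h)\<^sup>2 * convolution \<beta> \<beta> u"
      unfolding convolution_def by (simp only: sum.distrib sum_subtractf sum_distrib_left sum_constant)
    \<comment> \<open>The mixed terms vanish because \<beta> has sum 0.\<close>
    also have "\<dots> = ?N * (\<gamma> / ?h)\<^sup>2 + 1 / (?B * ?h)\<^sup>2 * (?h * c * \<beta> u)"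
      by (simp add: su sum0 conv[OF u])
    finally have AA: "convolution A A u = ?N * (\<gamma> / ?h)\<^sup>2 + q * \<beta> u / (?B * ?h)"
      using h nz by (simp add: q field_simps power2_eq_square)
    have "convolution A (\<lambda>g. A g + q * \<delta> g) u = convolution A A u + q * convolution A \<delta> u"
      unfolding convolution_def by (simp add: algebra_simps sum.distrib sum_distrib_left)
    also have "convolution A \<delta> u = A u" by (rule Ad)
    also have "A u = \<gamma> / ?h - \<beta> u / (?B * ?h)" by (simp add: A_def)
    finally have "convolution A (\<lambda>g. A g + q * \<delta> g) u =
        ?N * (\<gamma> / ?h)\<^sup>2 + q * \<beta> u / (?B * ?h) + q * (\<gamma> / ?h - \<beta> u / (?B * ?h))" unfolding AA .
    \<comment> \<open>The choice q = c/b makes the \<beta> term of the convolution of A with itself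
      cancel that of q A.\<close>
    also have "\<dots> = C" unfolding C_def using h nz
      by (simp add: field_simps power2_eq_square)
    finally show ?thesis .
  qed
  have "convolution (convolution A (\<lambda>g. A g + q * \<delta> g)) (\<lambda>g. A g + (1 - m) * \<delta> g) u = 0"
    if u: "u \<in> carrier G" for u
  proof -
    have "convolution (convolution A (\<lambda>g. A g + q * \<delta> g)) (\<lambda>g. A g + (1 - m) * \<delta> g) u =
        (\<Sum>x\<in>carrier G. C * (A x + (1 - m) * \<delta> x))"
      unfolding convolution_def[of "convolution A _"] using u by (intro sum.cong refl) (simp add: quad)
    \<comment> \<open>Convolving a constant with a function multiplies it by the sum of that
      function, here (m - 1) + (1 - m) = 0.\<close>
    also have "\<dots> = C * ((\<Sum>x\<in>carrier G. A x) + (1 - m) * (\<Sum>x\<in>carrier G. \<delta> x))"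
      by (simp only: sum_distrib_left[symmetric] sum.distrib)
    finally show ?thesis by (simp add: sumA sum\<delta>)
  qed
  then show ?thesis unfolding deg using represents_zero[OF rep _ z] by blast
qed

end

section \<open>The cubic equation\<close>

context finite_group
begin

text \<open>For V itself the sum over H is |H|, a number fixed by every automorphism, so each
  conjugate contributes the same.\<close>

lemma galois_character_sum_subgroup:
  fixes V :: "'g \<Rightarrow> complex mat"
  assumes W: "irreducible_rep G W" and assoc: "associated_complex_rep G W V"
    and H: "subgroup H G" and dim: "fixed_dim G V H = 1"
  shows "(\<Sum>h\<in>H. galois_character G V h) =
    of_nat (card (galois_group (character_field G V)) * card H)"
    and "card (galois_group (character_field G V)) > 0"
proof -
  let ?\<Gamma> = "galois_group (character_field G V)" and ?\<chi> = "rep_character V"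
  have V: "representation G V" using assoc unfolding associated_complex_rep_def irreducible_rep_def by blast
  note gal_facts = associated_complex_rep_galois[OF group_axioms W assoc]
  then show "card ?\<Gamma> > 0" by (simp add: card_gt_0_iff)
  from gal_facts obtain s where *: "\<forall>\<tau>\<in>?\<Gamma>. complex_automorphism (s \<tau>) \<and>
      (\<forall>x\<in>character_field G V. s \<tau> x = \<tau> x)" by (elim conjE exE)
  have ext: "\<tau> x = s \<tau> x" if "\<tau> \<in> ?\<Gamma>" "x \<in> character_field G V" for \<tau> x using * that by simp
  have "(\<Sum>h\<in>H. galois_character G V h) = (\<Sum>h\<in>H. \<Sum>\<tau>\<in>?\<Gamma>. s \<tau> (?\<chi> h))"
    unfolding galois_character_def galois_trace_def
    by (intro sum.cong refl ext rep_character_in_character_field subgroup.mem_carrier[OF H])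
  also have "\<dots> = (\<Sum>\<tau>\<in>?\<Gamma>. \<Sum>h\<in>H. s \<tau> (?\<chi> h))" by (rule sum.swap)
  also have "\<dots> = (\<Sum>\<tau>\<in>?\<Gamma>. of_nat (card H))"
  proof (rule sum.cong[OF refl])
    fix \<tau> assume "\<tau> \<in> ?\<Gamma>"
    then have s: "complex_automorphism (s \<tau>)" using * by blast
    show "(\<Sum>h\<in>H. s \<tau> (?\<chi> h)) = of_nat (card H)"
      using fixed_dim_one_character_sum[OF V H dim]
      by (simp add: complex_automorphism_of_nat[OF s] flip: complex_automorphism_sum[OF s])
  qed
  finally show "(\<Sum>h\<in>H. galois_character G V h) = of_nat (card ?\<Gamma> * card H)" by simp
qed

lemma of_int_a_coeff:
  fixes V :: "'g \<Rightarrow> complex mat"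
  assumes W: "irreducible_rep G W" and assoc: "associated_complex_rep G W V"
    and H: "subgroup H G" and x: "x \<in> carrier G"
  shows "of_int (a_coeff G H (character_field G V) V x) = (\<Sum>h\<in>H. galois_character G V (h \<otimes> inv x))"
proof -
  have "(\<Sum>h\<in>H. galois_character G V (h \<otimes> inv x)) \<in> \<int>"
    using galois_character_Ints[OF W assoc] subgroup.mem_carrier[OF H] x by (intro Ints_sum) auto
  then obtain a where a: "(\<Sum>h\<in>H. galois_character G V (h \<otimes> inv x)) = of_int a"
    by (auto elim: Ints_cases)
  then have "a_coeff G H (character_field G V) V x = a"
    unfolding a_coeff_def galois_character_def by (intro the_equality) auto
  then show ?thesis using a by simp
qed

end

theorem proposition3p9:
  fixes G :: "'g monoid" and H :: "'g set"
    and act :: "'g \<Rightarrow> 'k::{alg_closed_field, field_char_0} point \<Rightarrow> 'k point"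
    and NZ NX NY :: nat
    and Z X Y :: "'k point set"
    and \<pi> \<pi>\<^sub>H \<phi>\<^sub>H :: "'k point \<Rightarrow> 'k point"
    and r n d :: nat
    and W :: "nat \<Rightarrow> 'g \<Rightarrow> rat mat" and V :: "nat \<Rightarrow> 'g \<Rightarrow> complex mat"
    and L :: "complex set"
    and nn :: "nat \<Rightarrow> nat" and g :: "nat \<Rightarrow> nat \<Rightarrow> 'g"
  defines "b \<equiv> b_coeff G H L r V g"
  defines "K \<equiv> kanev_corr Z act \<pi>\<^sub>H d nn g b"
  assumes "group G" and "finite (carrier G)" and "subgroup H G"
    and "smooth_projective_curve NZ Z"
    and "faithful_action G Z act"
    and "\<forall>a\<in>carrier G. is_morphism NZ Z NZ Z (act a)"
    and "quotient_curve NZ Z act (carrier G) NY Y \<pi>"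
    and "quotient_curve NZ Z act H NX X \<pi>\<^sub>H"
    and "is_morphism NX X NY Y \<phi>\<^sub>H" and "\<forall>z\<in>Z. \<phi>\<^sub>H (\<pi>\<^sub>H z) = \<pi> z"
    and "1 \<le> r"
    and "\<forall>k\<in>{1..r}. irreducible_rep G (W k) \<and> \<not> rep_iso G (W k) trivial_rep"
    and "\<forall>k\<in>{1..r}. \<forall>l\<in>{1..r}. k \<noteq> l \<longrightarrow> \<not> rep_iso G (W k) (W l)"
    and "\<forall>k\<in>{1..r}. associated_complex_rep G (W k) (V k)"
    and "\<forall>k\<in>{1..r}. rep_dim G (V k) = n"
    and "\<forall>k\<in>{1..r}. character_field G (V k) = L"
    and "\<forall>k\<in>{1..r}. fixed_dim G (V k) H = 1"
    and "\<forall>N. subgroup N G \<and> H \<subset> N \<longrightarrow> (\<exists>k\<in>{1..r}. fixed_dim G (V k) N = 0)"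
    and "double_coset_reps G H d nn g"
  shows "\<exists>q::nat. 0 < q \<and>
    rat_of_nat q = of_nat (card (carrier G)) / (of_int (b_gcd d b) * of_nat n) \<and>
    (\<forall>x\<in>X. ((K -\<^sub>c \<Delta>\<^sub>c) \<circ>\<^sub>c (K +\<^sub>c (of_nat q - 1) \<cdot>\<^sub>c \<Delta>\<^sub>c)
              \<circ>\<^sub>c (K -\<^sub>c corr_degree X K \<cdot>\<^sub>c \<Delta>\<^sub>c)) x = 0)"
proof -
  interpret finite_group G using assms(3,4) by (intro finite_group.intro finite_group_axioms.intro)
  note H = assms(5) and reps = assms(21)
  have quot: "\<pi>\<^sub>H ` Z = X \<and> (\<forall>z\<in>Z. \<forall>z'\<in>Z. \<pi>\<^sub>H z = \<pi>\<^sub>H z' \<longleftrightarrow> (\<exists>a\<in>H. z' = act a z))"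
    using assms(10) unfolding quotient_curve_def by (elim conjE) (intro conjI)
  then have X: "X = \<pi>\<^sub>H ` Z" by simp
  interpret quotient_action G H Z act \<pi>\<^sub>H
    using H faithful_action.axioms(1)[OF assms(7)] quot
    by (intro quotient_action.intro quotient_action_axioms.intro finite_group_axioms) blast+
  have W: "irreducible_rep G (W k)" "\<not> rep_iso G (W k) trivial_rep"
    and V: "associated_complex_rep G (W k) (V k)" "rep_dim G (V k) = n" "character_field G (V k) = L"
      "fixed_dim G (V k) H = 1" if "k \<in> {1..r}" for k
    using assms that by blast+
  have Vrep: "representation G (V k)" and Vdim: "n > 0" if "k \<in> {1..r}" for k
    using V(1,2)[OF that] irreducible_repD[of G "V k"] unfolding associated_complex_rep_def by auto
  have n: "n > 0" using Vdim[of 1] assms(13) by simp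
  let ?N = "card (carrier G)" and ?h = "card H"
  define c :: complex where "c = of_nat ?N / of_nat n"
  define \<psi> where "\<psi> = (\<lambda>x. \<Sum>k=1..r. galois_character G (V k) x)"
  \<comment> \<open>B and \<beta> agree on G: the complex values of B are where the character
    relations live, the integral values of \<beta> are where divisibility makes sense.\<close>
  define B where "B = (\<lambda>x. \<Sum>h\<in>H. \<psi> (h \<otimes>\<^bsub>G\<^esub> inv\<^bsub>G\<^esub> x))"
  define \<beta> where "\<beta> = (\<lambda>x. \<Sum>k=1..r. a_coeff G H L (V k) x)"
  have \<psi>_class: "\<psi> (x \<otimes>\<^bsub>G\<^esub> y) = \<psi> (y \<otimes>\<^bsub>G\<^esub> x)" if "x \<in> carrier G" "y \<in> carrier G" for x y
    unfolding \<psi>_def by (intro sum.cong refl galois_character_class Vrep that)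
  have \<psi>_conv: "(\<Sum>x\<in>carrier G. \<psi> x * \<psi> (inv\<^bsub>G\<^esub> x \<otimes>\<^bsub>G\<^esub> u)) = c * \<psi> u" if u: "u \<in> carrier G" for u
  proof -
    let ?c = "\<lambda>k l. \<Sum>x\<in>carrier G. galois_character G (V k) x * galois_character G (V l) (inv\<^bsub>G\<^esub> x \<otimes>\<^bsub>G\<^esub> u)"
    have kl: "?c k l = (if k = l then c * galois_character G (V l) u else 0)"
      if k: "k \<in> {1..r}" and l: "l \<in> {1..r}" for k l
    proof (cases "k = l")
      case True
      then show ?thesis
        using galois_character_convolution_same[OF W(1)[OF l] V(1)[OF l] u] V(2)[OF l] by (simp add: c_def)
    next
      case False
      then have "\<not> rep_iso G (W l) (W k)" using assms(15)[rule_format, OF l k] by simp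
      from galois_character_convolution_distinct[OF W(1)[OF k] V(1)[OF k] W(1)[OF l] V(1)[OF l] this u]
      show ?thesis using False by simp
    qed
    have "(\<Sum>x\<in>carrier G. \<psi> x * \<psi> (inv\<^bsub>G\<^esub> x \<otimes>\<^bsub>G\<^esub> u)) = (\<Sum>k=1..r. \<Sum>l=1..r. ?c k l)"
      unfolding \<psi>_def sum_product by (subst sum.swap, rule sum.cong[OF refl], rule sum.swap)
    also have "\<dots> = (\<Sum>k=1..r. \<Sum>l=1..r. if k = l then c * galois_character G (V l) u else 0)"
      by (rule sum.cong[OF refl], rule sum.cong[OF refl], rule kl)
    also have "\<dots> = c * \<psi> u" by (simp add: \<psi>_def sum_distrib_left)
    finally show ?thesis .
  qed
  have "(\<Sum>x\<in>carrier G. \<psi> x) = (\<Sum>k=1..r. \<Sum>x\<in>carrier G. galois_character G (V k) x)"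
    unfolding \<psi>_def by (rule sum.swap)
  then have \<psi>_sum: "(\<Sum>x\<in>carrier G. \<psi> x) = 0" using galois_character_sum_zero[OF W(1) V(1) W(2)] by simp
  have B_bi: "bi_invariant H B"
    unfolding B_def by (intro averaged_class_function(1)[where \<psi> = \<psi>] H \<psi>_class)
  have B_sum: "(\<Sum>x\<in>carrier G. B x) = of_nat ?h * (\<Sum>x\<in>carrier G. \<psi> x)"
    unfolding B_def by (intro averaged_class_function(2)[where \<psi> = \<psi>] H \<psi>_class)
  have B_conv: "convolution B B u = of_nat ?h * c * B u" if "u \<in> carrier G" for u
    unfolding B_def by (intro averaged_class_function(3)[where \<psi> = \<psi>] H \<psi>_class \<psi>_conv that)
  have \<beta>B: "of_int (\<beta> x) = B x" if x: "x \<in> carrier G" for x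
  proof -
    have "of_int (\<beta> x) = (\<Sum>k=1..r. \<Sum>h\<in>H. galois_character G (V k) (h \<otimes>\<^bsub>G\<^esub> inv\<^bsub>G\<^esub> x))"
      unfolding \<beta>_def of_int_sum using of_int_a_coeff[OF W(1) V(1) H x] V(3) by (intro sum.cong) auto
    then show ?thesis unfolding B_def \<psi>_def by (simp add: sum.swap[of _ H])
  qed
  have \<beta>_bi: "bi_invariant H \<beta>"
    unfolding bi_invariant_def
  proof (intro ballI conjI)
    fix x a assume x: "x \<in> carrier G" and a: "a \<in> H"
    then have "B (a \<otimes>\<^bsub>G\<^esub> x) = B x" "B (x \<otimes>\<^bsub>G\<^esub> a) = B x" using B_bi unfolding bi_invariant_def by auto
    then have "complex_of_int (\<beta> (a \<otimes>\<^bsub>G\<^esub> x)) = of_int (\<beta> x)" "complex_of_int (\<beta> (x \<otimes>\<^bsub>G\<^esub> a)) = of_int (\<beta> x)"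
      using x HG[OF a] by (simp_all add: \<beta>B)
    then show "\<beta> (a \<otimes>\<^bsub>G\<^esub> x) = \<beta> x" "\<beta> (x \<otimes>\<^bsub>G\<^esub> a) = \<beta> x" by simp_all
  qed
  have "of_int (\<Sum>x\<in>carrier G. \<beta> x) = (\<Sum>x\<in>carrier G. B x)" by (simp add: \<beta>B)
  also have "\<dots> = 0" using B_sum \<psi>_sum by simp
  finally have \<beta>_sum: "(\<Sum>x\<in>carrier G. \<beta> x) = 0" by (simp only: of_int_eq_0_iff)
  have \<beta>_conv: "convolution (\<lambda>x. rat_of_int (\<beta> x)) (\<lambda>x. of_int (\<beta> x)) u =
      of_nat ?h * (of_nat ?N / of_nat n) * of_int (\<beta> u)" if u: "u \<in> carrier G" for u
  proof -
    let ?S = "\<Sum>x\<in>carrier G. \<beta> (u \<otimes>\<^bsub>G\<^esub> inv\<^bsub>G\<^esub> x) * \<beta> x"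
    have "complex_of_int ?S = convolution B B u"
      using u by (simp add: convolution_def \<beta>B)
    also have "\<dots> = of_nat ?h * c * of_int (\<beta> u)" using B_conv[OF u] \<beta>B[OF u] by simp
    \<comment> \<open>Clearing the denominator n lets the identity pass from the complex numbers to
      the integers, and from there to the rationals.\<close>
    finally have "complex_of_int (int n * ?S) = of_int (int (?h * ?N) * \<beta> u)"
      using n by (simp add: c_def)
    then have "int n * ?S = int (?h * ?N) * \<beta> u" by (simp only: of_int_eq_iff)
    then have "rat_of_int (int n * ?S) = of_int (int (?h * ?N) * \<beta> u)" by simp
    then show ?thesis using n by (simp add: convolution_def field_simps)
  qed
  have \<Gamma>_sum: "(\<Sum>h\<in>H. galois_character G (V k) h) = of_nat (card (galois_group L) * ?h)"
    and \<Gamma>: "card (galois_group L) > 0" if "k \<in> {1..r}" for k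
    using galois_character_sum_subgroup[OF W(1)[OF that] V(1)[OF that] H V(4)[OF that]] V(3)[OF that] by auto
  \<comment> \<open>At the identity every conjugate of every V_k contributes |H|, so the value is a
    product of positive numbers.\<close>
  have "B \<one>\<^bsub>G\<^esub> = (\<Sum>h\<in>H. \<Sum>k=1..r. galois_character G (V k) h)"
    unfolding B_def \<psi>_def using HG by simp
  also have "\<dots> = (\<Sum>k=1..r. \<Sum>h\<in>H. galois_character G (V k) h)" by (rule sum.swap)
  also have "\<dots> = of_nat (r * (card (galois_group L) * ?h))" using \<Gamma>_sum by simp
  finally have "B \<one>\<^bsub>G\<^esub> = of_nat (r * (card (galois_group L) * ?h))" .
  moreover have "r * (card (galois_group L) * ?h) > 0" using \<Gamma>[of 1] assms(13) card_H by simp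
  ultimately have "complex_of_int (\<beta> \<one>\<^bsub>G\<^esub>) \<noteq> 0" using \<beta>B[OF one_closed] by simp
  then have \<beta>1: "\<beta> \<one>\<^bsub>G\<^esub> \<noteq> 0" by simp
  have b: "b i = \<beta> (g i 1)" for i by (simp add: b_def b_coeff_def \<beta>_def)
  have d: "g 1 1 = \<one>\<^bsub>G\<^esub>" "(\<Union>i\<in>{1..d}. (H #>\<^bsub>G\<^esub> g i 1) <#>\<^bsub>G\<^esub> H) = carrier G"
    using reps unfolding double_coset_reps_def by auto
  \<comment> \<open>Every value of \<beta> is some b i, since \<beta> is constant on double cosets;
    the index 1, absent from the gcd, gives the difference 0.\<close>
  have b_dvd: "b_gcd d b dvd \<beta> x - \<beta> \<one>\<^bsub>G\<^esub>" if xG: "x \<in> carrier G" for x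
  proof -
    obtain i where i: "i \<in> {1..d}" "x \<in> (H #>\<^bsub>G\<^esub> g i 1) <#>\<^bsub>G\<^esub> H" using xG d(2) by blast
    have x: "\<beta> x = b i" using bi_invariant_double_coset_reps[OF H reps \<beta>_bi i] b by simp
    have "b_gcd d b dvd b 1 - b i"
    proof (cases "i = 1")
      case False
      then show ?thesis unfolding b_gcd_def using i(1) by (intro Gcd_dvd) auto
    qed simp
    then show ?thesis using x b[of 1] d(1) by (simp add: dvd_diff_commute)
  qed
  have N: "?N > 0" using fin one_closed by (metis card_gt_0_iff empty_iff)
  \<comment> \<open>This also excludes d = 1, where the gcd of the empty set would be 0.\<close>
  have b0: "b_gcd d b \<noteq> 0"
  proof
    assume "b_gcd d b = 0"
    then have "\<beta> x = \<beta> \<one>\<^bsub>G\<^esub>" if "x \<in> carrier G" for x using b_dvd[OF that] by simp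
    then have "(\<Sum>x\<in>carrier G. \<beta> x) = (\<Sum>x\<in>carrier G. \<beta> \<one>\<^bsub>G\<^esub>)" by (intro sum.cong refl)
    then have "(\<Sum>x\<in>carrier G. \<beta> x) = of_nat ?N * \<beta> \<one>\<^bsub>G\<^esub>" by (simp only: sum_constant)
    then show False using \<beta>_sum \<beta>1 N by simp
  qed
  have bpos: "b_gcd d b > 0"
    using b0 Gcd_int_greater_eq_0[of "{b 1 - b i |i. 2 \<le> i \<and> i \<le> d}"] unfolding b_gcd_def by linarith
  let ?q = "of_nat ?N / of_nat n / of_int (b_gcd d b) :: rat"
  have "?q \<in> \<int>"
    using convolution_eigenvalue_int[OF H reps \<beta>_bi \<beta>_sum _ b0 b_dvd \<beta>1] \<beta>_conv
    unfolding convolution_def by blast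
  then obtain m where m: "?q = of_int m" by (elim Ints_cases)
  have "?q > 0" using n bpos N by (intro divide_pos_pos) auto
  then have "m > 0" unfolding m by simp
  with m have q: "nat m > 0" "rat_of_nat (nat m) = ?q" by (simp_all add: of_nat_nat)
  have \<beta>_bi': "bi_invariant H (\<lambda>x. rat_of_int (\<beta> x))" using \<beta>_bi unfolding bi_invariant_def by simp
  have "((K -\<^sub>c \<Delta>\<^sub>c) \<circ>\<^sub>c (K +\<^sub>c (of_nat (nat m) - 1) \<cdot>\<^sub>c \<Delta>\<^sub>c)
      \<circ>\<^sub>c (K -\<^sub>c corr_degree (\<pi>\<^sub>H ` Z) K \<cdot>\<^sub>c \<Delta>\<^sub>c)) (\<pi>\<^sub>H z) = 0" if "z \<in> Z" for z
    unfolding K_def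
  proof (rule kanev_cubic[OF reps \<beta>_bi' _ _ \<beta>_conv q(2) b0 that])
    show "(\<Sum>x\<in>carrier G. rat_of_int (\<beta> x)) = 0" using \<beta>_sum by (simp flip: of_int_sum)
  qed (simp add: b)
  then show ?thesis unfolding X using q by (intro exI[of _ "nat m"]) (auto simp: field_simps)
qed

end
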